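(* Let $(\mathsf C,\otimes,K)$ be a braided monoidal small category, $X$ a set, and let $(\{(a(x,y),\delta_{x,y},\varepsilon_{x,y})\}_{(x,y)\in X^2},\{\mu_{x,y,z}\}_{(x,y,z)\in X^3},\{\eta_x\}_{x\in X})$ be a Hopf $\mathsf C$-category with object set $X$. The following assertions are equivalent. (i) The monoid $(\{a(x,y)\},\{\mu_{x,y,z}\},\{\eta_x\})$ in $((\mathsf{span}\vert\mathsf C)(X,X),\circ,i)$ admits a separability structure; that is, there is a family of morphisms $\{\partial_{x,y,z}:a(x,z)\to a(x,y)\otimes a(y,z)\}_{(x,y,z)\in X^3}$ in $\mathsf C$ such that for all $x,y,v,z\in X$ $$(1\otimes\mu_{v,y,z})(\partial_{x,v,y}\otimes1)=\partial_{x,v,z}\,\mu_{x,y,z}=(\mu_{x,y,v}\otimes1)(1\otimes\partial_{y,v,z}),\qquad \mu_{x,v,y}\,\partial_{x,v,y}=1_{a(x,y)}.$$ (ii) There exists a normalized left integral family; that is, a family of morphisms $\{\theta_{x,y}:K\to a(x,y)\}_{x,y\in X}$ in $\mathsf C$ such that for all $x,y,z\in X$ $$\mu_{x,y,z}(1\otimes\theta_{y,z})=\theta_{x,z}\,\varepsilon_{x,y}:a(x,y)\to a(x,z),\qquad \varepsilon_{x,y}\,\theta_{x,y}=1_K.$$ (iii) There exists a normalized right integral family; that is, a family of morphisms $\{\theta_{x,y}:K\to a(x,y)\}_{x,y\in X}$ in $\mathsf C$ such that for all $x,y,z\in X$ $$\mu_{x,y,z}(\theta_{x,y}\otimes1)=\theta_{x,z}\,\varepsilon_{y,z}:a(y,z)\to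 a(x,z),\qquad \varepsilon_{x,y}\,\theta_{x,y}=1_K.$$
   Context: Associativity and unit isomorphisms of $\otimes$ are suppressed. Hopf $\mathsf C$-category. A category enriched in the monoidal category of comonoids in the braided monoidal category $\mathsf C$, with object set $X$, consists of comonoids $(a(x,y),\delta_{x,y},\varepsilon_{x,y})$ in $\mathsf C$ for $x,y\in X$, composition morphisms $\mu_{x,y,z}:a(x,y)\otimes a(y,z)\to a(x,z)$ and unit morphisms $\eta_x:K\to a(x,x)$, all of them comonoid morphisms, associative and unital. It is a Hopf $\mathsf C$-category if there are morphisms $\sigma_{x,y}:a(x,y)\to a(y,x)$ in $\mathsf C$ with $\mu_{x,y,x}(1\otimes\sigma_{x,y})\delta_{x,y}=\eta_x\varepsilon_{x,y}$ and $\mu_{y,x,y}(\sigma_{x,y}\otimes1)\delta_{x,y}=\eta_y\varepsilon_{x,y}$ for all $x,y\in X$. The monoidal category $((\mathsf{span}\vert\mathsf C)(X,X),\circ,i)$ (needed only for the first phrase of (i), whose meaning is spelled out there). An object is a span of sets $X\leftarrow A\to X$ with a map $a$ from $A$ to the set of objects of $\mathsf C$; a morphism $(A',a')\to(A,a)$ is a map of spans $f:A'\to A$ with morphisms $\varphi_h:a'(h)\to a(f(h))$, $h\in A'$. The $\circ$-product of $(A,a)$ and $(B,b)$ is the pullback span $B\circ A$ with the map $(d,h)\mapsto b(d)\otimes a(h)$, and the unit $i$ is the identity span on $X$ with the constant map at $K$. The monoid in (i) lives on the span $X\xleftarrow{p_1}X^2\xrightarrow{p_2}X$ with the map $(x,y)\mapsto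 a(x,y)$; its multiplication is $X^2\circ X^2\cong X^3\xrightarrow{p_{13}}X^2$ with the morphisms $\mu_{x,y,z}$, and its unit is the diagonal $X\to X^2$ with the morphisms $\eta_x$. *)

theory Defs
  imports Main
begin

section \<open>Braided monoidal small categories\<close>

text \<open>
  A small category has a set of objects and a set of arrows, each carried by a HOL type.
  Nothing is required of the operations outside these sets. Composition is written in the
  usual order: \<open>g \<cdot> f\<close> is first \<open>f\<close>, then \<open>g\<close>; it binds more weakly than the tensor products.
\<close>

record ('o, 'm) cat =
  Obj  :: "'o set"
  Arr  :: "'m set"
  Dom  :: "'m \<Rightarrow> 'o"
  Cod  :: "'m \<Rightarrow> 'o"
  Id   :: "'o \<Rightarrow> 'm"  ("\<one>\<index>")
  Comp :: "'m \<Rightarrow> 'm \<Rightarrow> 'm"  (infixr "\<cdot>\<index>" 55)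

definition Hom :: "('o, 'm, 'z) cat_scheme \<Rightarrow> 'o \<Rightarrow> 'o \<Rightarrow> 'm set"
  where "Hom C A B = {f \<in> Arr C. Dom C f = A \<and> Cod C f = B}"

definition inverse_arrows :: "('o, 'm, 'z) cat_scheme \<Rightarrow> 'm \<Rightarrow> 'm \<Rightarrow> bool"
  where "inverse_arrows C f g \<longleftrightarrow>
    f \<in> Arr C \<and> g \<in> Hom C (Cod C f) (Dom C f) \<and>
    g \<cdot>\<^bsub>C\<^esub> f = \<one>\<^bsub>C\<^esub> (Dom C f) \<and> f \<cdot>\<^bsub>C\<^esub> g = \<one>\<^bsub>C\<^esub> (Cod C f)"

definition iso :: "('o, 'm, 'z) cat_scheme \<Rightarrow> 'm \<Rightarrow> bool"
  where "iso C f \<longleftrightarrow> (\<exists>g. inverse_arrows C f g)"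

definition inv_arr :: "('o, 'm, 'z) cat_scheme \<Rightarrow> 'm \<Rightarrow> 'm"  ("inv\<index> _" [1000] 999)
  where "inv\<^bsub>C\<^esub> f = (THE g. inverse_arrows C f g)"

locale small_category =
  fixes C (structure)
  assumes Dom_obj: "f \<in> Arr C \<Longrightarrow> Dom C f \<in> Obj C"
    and Cod_obj: "f \<in> Arr C \<Longrightarrow> Cod C f \<in> Obj C"
    and Id_hom: "A \<in> Obj C \<Longrightarrow> \<one> A \<in> Hom C A A"
    and Comp_hom: "\<lbrakk>f \<in> Hom C A B; g \<in> Hom C B D\<rbrakk> \<Longrightarrow> g \<cdot> f \<in> Hom C A D"
    and Comp_assoc: "\<lbrakk>f \<in> Hom C A B; g \<in> Hom C B D; h \<in> Hom C D E\<rbrakk>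
      \<Longrightarrow> (h \<cdot> g) \<cdot> f = h \<cdot> (g \<cdot> f)"
    and Id_left: "f \<in> Hom C A B \<Longrightarrow> \<one> B \<cdot> f = f"
    and Id_right: "f \<in> Hom C A B \<Longrightarrow> f \<cdot> \<one> A = f"

text \<open>
  The monoidal structure is not assumed to be strict:
  \<open>\<alpha> A B D : (A \<odot> B) \<odot> D \<rightarrow> A \<odot> (B \<odot> D)\<close>,
  \<open>\<ll> A : K \<odot> A \<rightarrow> A\<close> and \<open>\<rr> A : A \<odot> K \<rightarrow> A\<close>.
  The product on objects is \<open>\<odot>\<close>, the one on arrows is \<open>\<otimes>\<close>.
\<close>

record ('o, 'm) moncat = "('o, 'm) cat" +
  Tobj  :: "'o \<Rightarrow> 'o \<Rightarrow> 'o"  (infixr "\<odot>\<index>" 70)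
  Tarr  :: "'m \<Rightarrow> 'm \<Rightarrow> 'm"  (infixr "\<otimes>\<index>" 70)
  Unit  :: "'o"  ("\<K>\<index>")
  Assoc :: "'o \<Rightarrow> 'o \<Rightarrow> 'o \<Rightarrow> 'm"  ("\<alpha>\<index>")
  Lunit :: "'o \<Rightarrow> 'm"  ("\<ll>\<index>")
  Runit :: "'o \<Rightarrow> 'm"  ("\<rr>\<index>")

locale monoidal_category = small_category C for C (structure) +
  assumes Tobj_obj: "\<lbrakk>A \<in> Obj C; B \<in> Obj C\<rbrakk> \<Longrightarrow> A \<odot> B \<in> Obj C"
    and Unit_obj: "\<K> \<in> Obj C"
    and Tarr_hom: "\<lbrakk>f \<in> Hom C A B; g \<in> Hom C A' B'\<rbrakk> \<Longrightarrow> f \<otimes> g \<in> Hom C (A \<odot> A') (B \<odot> B')"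
    and Tarr_Id: "\<lbrakk>A \<in> Obj C; B \<in> Obj C\<rbrakk> \<Longrightarrow> \<one> A \<otimes> \<one> B = \<one> (A \<odot> B)"
    and Tarr_Comp: "\<lbrakk>f \<in> Hom C A B; g \<in> Hom C B D; f' \<in> Hom C A' B'; g' \<in> Hom C B' D'\<rbrakk>
      \<Longrightarrow> (g \<cdot> f) \<otimes> (g' \<cdot> f') = (g \<otimes> g') \<cdot> (f \<otimes> f')"
    and Assoc_hom: "\<lbrakk>A \<in> Obj C; B \<in> Obj C; D \<in> Obj C\<rbrakk>
      \<Longrightarrow> \<alpha> A B D \<in> Hom C ((A \<odot> B) \<odot> D) (A \<odot> (B \<odot> D))"
    and Assoc_iso: "\<lbrakk>A \<in> Obj C; B \<in> Obj C; D \<in> Obj C\<rbrakk> \<Longrightarrow> iso C (\<alpha> A B D)"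
    and Assoc_natural: "\<lbrakk>f \<in> Hom C A A'; g \<in> Hom C B B'; h \<in> Hom C D D'\<rbrakk>
      \<Longrightarrow> \<alpha> A' B' D' \<cdot> ((f \<otimes> g) \<otimes> h) = (f \<otimes> (g \<otimes> h)) \<cdot> \<alpha> A B D"
    and Lunit_hom: "A \<in> Obj C \<Longrightarrow> \<ll> A \<in> Hom C (\<K> \<odot> A) A"
    and Lunit_iso: "A \<in> Obj C \<Longrightarrow> iso C (\<ll> A)"
    and Lunit_natural: "f \<in> Hom C A B \<Longrightarrow> \<ll> B \<cdot> (\<one> \<K> \<otimes> f) = f \<cdot> \<ll> A"
    and Runit_hom: "A \<in> Obj C \<Longrightarrow> \<rr> A \<in> Hom C (A \<odot> \<K>) A"
    and Runit_iso: "A \<in> Obj C \<Longrightarrow> iso C (\<rr> A)"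
    and Runit_natural: "f \<in> Hom C A B \<Longrightarrow> \<rr> B \<cdot> (f \<otimes> \<one> \<K>) = f \<cdot> \<rr> A"
    and triangle: "\<lbrakk>A \<in> Obj C; B \<in> Obj C\<rbrakk> \<Longrightarrow> (\<one> A \<otimes> \<ll> B) \<cdot> \<alpha> A \<K> B = \<rr> A \<otimes> \<one> B"
    and pentagon: "\<lbrakk>A \<in> Obj C; B \<in> Obj C; D \<in> Obj C; E \<in> Obj C\<rbrakk>
      \<Longrightarrow> (\<one> A \<otimes> \<alpha> B D E) \<cdot> \<alpha> A (B \<odot> D) E \<cdot> (\<alpha> A B D \<otimes> \<one> E)
        = \<alpha> A B (D \<odot> E) \<cdot> \<alpha> (A \<odot> B) D E"

text \<open>The braiding is \<open>\<gamma> A B : A \<odot> B \<rightarrow> B \<odot> A\<close>; it need not be a symmetry.\<close>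

record ('o, 'm) brcat = "('o, 'm) moncat" +
  Braid :: "'o \<Rightarrow> 'o \<Rightarrow> 'm"  ("\<gamma>\<index>")

locale braided_monoidal_category = monoidal_category C for C (structure) +
  assumes Braid_hom: "\<lbrakk>A \<in> Obj C; B \<in> Obj C\<rbrakk> \<Longrightarrow> \<gamma> A B \<in> Hom C (A \<odot> B) (B \<odot> A)"
    and Braid_iso: "\<lbrakk>A \<in> Obj C; B \<in> Obj C\<rbrakk> \<Longrightarrow> iso C (\<gamma> A B)"
    and Braid_natural: "\<lbrakk>f \<in> Hom C A A'; g \<in> Hom C B B'\<rbrakk>
      \<Longrightarrow> \<gamma> A' B' \<cdot> (f \<otimes> g) = (g \<otimes> f) \<cdot> \<gamma> A B"
    and hexagon1: "\<lbrakk>A \<in> Obj C; B \<in> Obj C; D \<in> Obj C\<rbrakk>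
      \<Longrightarrow> \<alpha> B D A \<cdot> \<gamma> A (B \<odot> D) \<cdot> \<alpha> A B D
        = (\<one> B \<otimes> \<gamma> A D) \<cdot> \<alpha> B A D \<cdot> (\<gamma> A B \<otimes> \<one> D)"
    and hexagon2: "\<lbrakk>A \<in> Obj C; B \<in> Obj C; D \<in> Obj C\<rbrakk>
      \<Longrightarrow> inv (\<alpha> D A B) \<cdot> \<gamma> (A \<odot> B) D \<cdot> inv (\<alpha> A B D)
        = (\<gamma> A D \<otimes> \<one> B) \<cdot> inv (\<alpha> A D B) \<cdot> (\<one> A \<otimes> \<gamma> B D)"


section \<open>Comonoids and Hopf categories\<close>

context
  fixes C :: "('o, 'm, 'z) brcat_scheme" (structure)
begin

definition comonoid :: "'o \<Rightarrow> 'm \<Rightarrow> 'm \<Rightarrow> bool"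
  where "comonoid A \<delta> \<epsilon> \<longleftrightarrow>
    A \<in> Obj C \<and> \<delta> \<in> Hom C A (A \<odot> A) \<and> \<epsilon> \<in> Hom C A \<K> \<and>
    \<alpha> A A A \<cdot> (\<delta> \<otimes> \<one> A) \<cdot> \<delta> = (\<one> A \<otimes> \<delta>) \<cdot> \<delta> \<and>
    \<ll> A \<cdot> (\<epsilon> \<otimes> \<one> A) \<cdot> \<delta> = \<one> A \<and>
    \<rr> A \<cdot> (\<one> A \<otimes> \<epsilon>) \<cdot> \<delta> = \<one> A"

definition comonoid_hom :: "'o \<Rightarrow> 'm \<Rightarrow> 'm \<Rightarrow> 'o \<Rightarrow> 'm \<Rightarrow> 'm \<Rightarrow> 'm \<Rightarrow> bool"
  where "comonoid_hom A \<delta> \<epsilon> B \<delta>' \<epsilon>' f \<longleftrightarrow>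
    f \<in> Hom C A B \<and> \<delta>' \<cdot> f = (f \<otimes> f) \<cdot> \<delta> \<and> \<epsilon>' \<cdot> f = \<epsilon>"

text \<open>
  The monoidal structure of the category of comonoids: the tensor product of
  \<open>(A, \<delta>, \<epsilon>)\<close> and \<open>(B, \<delta>', \<epsilon>')\<close> is \<open>A \<odot> B\<close> with comultiplication
  \<open>(1 \<otimes> \<gamma> A B \<otimes> 1) \<cdot> (\<delta> \<otimes> \<delta>')\<close> up to bracketing, and the unit is \<open>K\<close>.
\<close>

definition tensor_comult :: "'o \<Rightarrow> 'm \<Rightarrow> 'o \<Rightarrow> 'm \<Rightarrow> 'm"
  where "tensor_comult A \<delta> B \<delta>' =
    inv (\<alpha> A B (A \<odot> B)) \<cdot> (\<one> A \<otimes> \<alpha> B A B) \<cdot> (\<one> A \<otimes> (\<gamma> A B \<otimes> \<one> B)) \<cdot>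
    (\<one> A \<otimes> inv (\<alpha> A B B)) \<cdot> \<alpha> A A (B \<odot> B) \<cdot> (\<delta> \<otimes> \<delta>')"

definition tensor_counit :: "'m \<Rightarrow> 'm \<Rightarrow> 'm"
  where "tensor_counit \<epsilon> \<epsilon>' = \<ll> \<K> \<cdot> (\<epsilon> \<otimes> \<epsilon>')"

definition unit_comult :: "'m"
  where "unit_comult = inv (\<ll> \<K>)"

definition unit_counit :: "'m"
  where "unit_counit = \<one> \<K>"

text \<open>
  Categories with object set \<open>X\<close> enriched in comonoids. Composition follows the diagrammatic
  order: \<open>\<mu> x y z : a x y \<odot> a y z \<rightarrow> a x z\<close>.
\<close>

definition comonoid_enriched_category ::
  "'x set \<Rightarrow> ('x \<Rightarrow> 'x \<Rightarrow> 'o) \<Rightarrow> ('x \<Rightarrow> 'x \<Rightarrow> 'm) \<Rightarrow> ('x \<Rightarrow> 'x \<Rightarrow> 'm) \<Rightarrow>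
    ('x \<Rightarrow> 'x \<Rightarrow> 'x \<Rightarrow> 'm) \<Rightarrow> ('x \<Rightarrow> 'm) \<Rightarrow> bool"
  where "comonoid_enriched_category X a \<delta> \<epsilon> \<mu> \<eta> \<longleftrightarrow>
    (\<forall>x\<in>X. \<forall>y\<in>X. comonoid (a x y) (\<delta> x y) (\<epsilon> x y)) \<and>
    (\<forall>x\<in>X. \<forall>y\<in>X. \<forall>z\<in>X.
      comonoid_hom
        (a x y \<odot> a y z)
        (tensor_comult (a x y) (\<delta> x y) (a y z) (\<delta> y z))
        (tensor_counit (\<epsilon> x y) (\<epsilon> y z))
        (a x z) (\<delta> x z) (\<epsilon> x z) (\<mu> x y z)) \<and>
    (\<forall>x\<in>X. comonoid_hom \<K> unit_comult unit_counit (a x x) (\<delta> x x) (\<epsilon> x x) (\<eta> x)) \<and>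
    (\<forall>x\<in>X. \<forall>y\<in>X. \<forall>z\<in>X. \<forall>w\<in>X.
      \<mu> x z w \<cdot> (\<mu> x y z \<otimes> \<one> (a z w))
        = \<mu> x y w \<cdot> (\<one> (a x y) \<otimes> \<mu> y z w) \<cdot> \<alpha> (a x y) (a y z) (a z w)) \<and>
    (\<forall>x\<in>X. \<forall>y\<in>X.
      \<mu> x x y \<cdot> (\<eta> x \<otimes> \<one> (a x y)) = \<ll> (a x y) \<and>
      \<mu> x y y \<cdot> (\<one> (a x y) \<otimes> \<eta> y) = \<rr> (a x y))"

definition hopf_category ::
  "'x set \<Rightarrow> ('x \<Rightarrow> 'x \<Rightarrow> 'o) \<Rightarrow> ('x \<Rightarrow> 'x \<Rightarrow> 'm) \<Rightarrow> ('x \<Rightarrow> 'x \<Rightarrow> 'm) \<Rightarrow>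
    ('x \<Rightarrow> 'x \<Rightarrow> 'x \<Rightarrow> 'm) \<Rightarrow> ('x \<Rightarrow> 'm) \<Rightarrow> bool"
  where "hopf_category X a \<delta> \<epsilon> \<mu> \<eta> \<longleftrightarrow>
    comonoid_enriched_category X a \<delta> \<epsilon> \<mu> \<eta> \<and>
    (\<exists>\<sigma>. \<forall>x\<in>X. \<forall>y\<in>X.
      \<sigma> x y \<in> Hom C (a x y) (a y x) \<and>
      \<mu> x y x \<cdot> (\<one> (a x y) \<otimes> \<sigma> x y) \<cdot> \<delta> x y = \<eta> x \<cdot> \<epsilon> x y \<and>
      \<mu> y x y \<cdot> (\<sigma> x y \<otimes> \<one> (a x y)) \<cdot> \<delta> x y = \<eta> y \<cdot> \<epsilon> x y)"


section \<open>Separability structures and normalized integral families\<close>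

definition separability_structure ::
  "'x set \<Rightarrow> ('x \<Rightarrow> 'x \<Rightarrow> 'o) \<Rightarrow> ('x \<Rightarrow> 'x \<Rightarrow> 'x \<Rightarrow> 'm) \<Rightarrow> ('x \<Rightarrow> 'x \<Rightarrow> 'x \<Rightarrow> 'm) \<Rightarrow> bool"
  where "separability_structure X a \<mu> \<Delta> \<longleftrightarrow>
    (\<forall>x\<in>X. \<forall>y\<in>X. \<forall>z\<in>X. \<Delta> x y z \<in> Hom C (a x z) (a x y \<odot> a y z)) \<and>
    (\<forall>x\<in>X. \<forall>y\<in>X. \<forall>v\<in>X. \<forall>z\<in>X.
      (\<one> (a x v) \<otimes> \<mu> v y z) \<cdot> \<alpha> (a x v) (a v y) (a y z) \<cdot> (\<Delta> x v y \<otimes> \<one> (a y z))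
        = \<Delta> x v z \<cdot> \<mu> x y z \<and>
      \<Delta> x v z \<cdot> \<mu> x y z
        = (\<mu> x y v \<otimes> \<one> (a v z)) \<cdot> inv (\<alpha> (a x y) (a y v) (a v z)) \<cdot> (\<one> (a x y) \<otimes> \<Delta> y v z) \<and>
      \<mu> x v y \<cdot> \<Delta> x v y = \<one> (a x y))"

definition normalized_left_integral_family ::
  "'x set \<Rightarrow> ('x \<Rightarrow> 'x \<Rightarrow> 'o) \<Rightarrow> ('x \<Rightarrow> 'x \<Rightarrow> 'm) \<Rightarrow> ('x \<Rightarrow> 'x \<Rightarrow> 'x \<Rightarrow> 'm) \<Rightarrow>
    ('x \<Rightarrow> 'x \<Rightarrow> 'm) \<Rightarrow> bool"
  where "normalized_left_integral_family X a \<epsilon> \<mu> \<theta> \<longleftrightarrow>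
    (\<forall>x\<in>X. \<forall>y\<in>X. \<theta> x y \<in> Hom C \<K> (a x y)) \<and>
    (\<forall>x\<in>X. \<forall>y\<in>X. \<forall>z\<in>X.
      \<mu> x y z \<cdot> (\<one> (a x y) \<otimes> \<theta> y z) \<cdot> inv (\<rr> (a x y)) = \<theta> x z \<cdot> \<epsilon> x y) \<and>
    (\<forall>x\<in>X. \<forall>y\<in>X. \<epsilon> x y \<cdot> \<theta> x y = \<one> \<K>)"

definition normalized_right_integral_family ::
  "'x set \<Rightarrow> ('x \<Rightarrow> 'x \<Rightarrow> 'o) \<Rightarrow> ('x \<Rightarrow> 'x \<Rightarrow> 'm) \<Rightarrow> ('x \<Rightarrow> 'x \<Rightarrow> 'x \<Rightarrow> 'm) \<Rightarrow>
    ('x \<Rightarrow> 'x \<Rightarrow> 'm) \<Rightarrow> bool"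
  where "normalized_right_integral_family X a \<epsilon> \<mu> \<theta> \<longleftrightarrow>
    (\<forall>x\<in>X. \<forall>y\<in>X. \<theta> x y \<in> Hom C \<K> (a x y)) \<and>
    (\<forall>x\<in>X. \<forall>y\<in>X. \<forall>z\<in>X.
      \<mu> x y z \<cdot> (\<theta> x y \<otimes> \<one> (a y z)) \<cdot> inv (\<ll> (a y z)) = \<theta> x z \<cdot> \<epsilon> y z) \<and>
    (\<forall>x\<in>X. \<forall>y\<in>X. \<epsilon> x y \<cdot> \<theta> x y = \<one> \<K>)"

end

end

theory Submission imports Defs
begin

text \<open>
  Every structure morphism \<open>f\<close> is replaced by the family \<open>f \<otimes> 1\<^sub>Z\<close>, composed with associators and unitors
  so that its source and target are bracketed to the right with \<open>Z\<close> innermost. The families are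
  natural in \<open>Z\<close>; in terms of them the axioms contain no coherence isomorphisms and read as in a strict
  category. Nothing is lost, since \<open>- \<otimes> 1\<^sub>K\<close> is faithful.

  A separability structure \<open>\<partial>\<close> gives the integrals
  \<open>(1 \<otimes> \<epsilon>\<^sub>y\<^sub>x) \<partial>\<^sub>x\<^sub>y\<^sub>x \<eta>\<^sub>x\<close> (left) and \<open>(\<epsilon>\<^sub>y\<^sub>x \<otimes> 1) \<partial>\<^sub>y\<^sub>x\<^sub>y \<eta>\<^sub>y\<close> (right). Conversely, let \<open>\<theta>\<close> be a
  normalized left integral family and put \<open>e\<^sub>y\<^sub>v = (1 \<otimes> \<sigma>) \<delta> \<theta>\<^sub>y\<^sub>v\<close>. The morphisms
  \<open>(\<mu> \<otimes> 1)(1 \<otimes> e\<^sub>y\<^sub>v)\<close> and \<open>(1 \<otimes> \<mu>)(e\<^sub>x\<^sub>v \<otimes> 1)\<close> from \<open>a\<^sub>x\<^sub>y\<close> to \<open>a\<^sub>x\<^sub>v \<otimes> a\<^sub>v\<^sub>y\<close> agree, because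
  the canonical isomorphism \<open>(1 \<otimes> \<mu>)(\<delta> \<otimes> 1)\<close>, inverted with the antipode, sends both to \<open>\<theta>\<^sub>x\<^sub>v \<otimes> 1\<close>;
  this avoids the anti-multiplicativity of \<open>\<sigma>\<close>. Their common value is a separability structure.
  Right integrals are treated in the same way with \<open>(\<mu> \<otimes> 1)(1 \<otimes> \<delta>)\<close>.
\<close>

section \<open>Monoidal categories\<close>

context small_category
begin

lemma HomI [intro]: "\<lbrakk>f \<in> Arr C; Dom C f = A; Cod C f = B\<rbrakk> \<Longrightarrow> f \<in> Hom C A B"
  by (simp add: Hom_def)

lemma Hom_arr: "f \<in> Hom C A B \<Longrightarrow> f \<in> Arr C \<and> Dom C f = A \<and> Cod C f = B"
  by (simp add: Hom_def)

lemma Hom_obj: "f \<in> Hom C A B \<Longrightarrow> A \<in> Obj C \<and> B \<in> Obj C"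
  using Dom_obj Cod_obj by (auto simp: Hom_def)

lemma Id_arr [simp]:
  assumes "A \<in> Obj C"
  shows "\<one> A \<in> Arr C" "Dom C (\<one> A) = A" "Cod C (\<one> A) = A"
  using Id_hom[OF assms] by (auto simp: Hom_def)

text \<open>Typing through \<open>Dom\<close> and \<open>Cod\<close> as rewrite rules, rather than
  through \<open>Hom\<close> with explicit objects, lets the simplifier discharge the composability
  conditions of long composites.\<close>

lemma Comp_arr [simp]:
  assumes "f \<in> Arr C" "g \<in> Arr C" "Cod C f = Dom C g"
  shows "g \<cdot> f \<in> Arr C" "Dom C (g \<cdot> f) = Dom C f" "Cod C (g \<cdot> f) = Cod C g"
  using Comp_hom[of f "Dom C f" "Cod C f" g "Cod C g"] assms by (auto simp: Hom_def)

lemma Comp_assoc_arr [simp]: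
  assumes "f \<in> Arr C" "g \<in> Arr C" "h \<in> Arr C" "Cod C f = Dom C g" "Cod C g = Dom C h"
  shows "(h \<cdot> g) \<cdot> f = h \<cdot> (g \<cdot> f)"
  using assms by (intro Comp_assoc) auto

lemma Id_left_arr [simp]: "\<lbrakk>f \<in> Arr C; Cod C f = B\<rbrakk> \<Longrightarrow> \<one> B \<cdot> f = f"
  by (rule Id_left) auto

lemma Id_right_arr [simp]: "\<lbrakk>f \<in> Arr C; Dom C f = A\<rbrakk> \<Longrightarrow> f \<cdot> \<one> A = f"
  by (rule Id_right) auto

text \<open>Composites are normalized to the right, so \<open>g \<cdot> f\<close> no longer occurs
  literally once another arrow precedes it. With the trailing \<open>k\<close> an equation can be
  applied inside a longer composite.\<close>

lemma Comp_reassoc: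
  assumes "g \<cdot> f = h" "f \<in> Arr C" "g \<in> Arr C" "Cod C f = Dom C g" "k \<in> Arr C" "Cod C k = Dom C f"
  shows "g \<cdot> (f \<cdot> k) = h \<cdot> k"
  using Comp_assoc_arr[of k f g] assms by simp

text \<open>Since \<open>inv\<close> is a definite description, uniqueness of the inverse is needed
  as well as existence.\<close>

lemma inverse_arrows_inv:
  assumes "iso C f"
  shows "inverse_arrows C f (inv f)"
proof -
  obtain g where g: "inverse_arrows C f g"
    using assms by (auto simp: iso_def)
  have "g' = g" if "inverse_arrows C f g'" for g'
  proof -
    have "g' = (g \<cdot> f) \<cdot> g'"
      using g that by (simp add: inverse_arrows_def Hom_def del: Comp_assoc_arr)
    also have "\<dots> = g \<cdot> (f \<cdot> g')"
      using g that by (intro Comp_assoc_arr) (auto simp: inverse_arrows_def Hom_def)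
    also have "\<dots> = g"
      using g that by (simp add: inverse_arrows_def Hom_def)
    finally show ?thesis .
  qed
  then show ?thesis
    unfolding inv_arr_def using g by (metis theI)
qed

lemma
  assumes "iso C f"
  shows iso_arr: "f \<in> Arr C"
    and inv_arr: "inv f \<in> Arr C" "Dom C (inv f) = Cod C f" "Cod C (inv f) = Dom C f"
    and inv_Comp: "inv f \<cdot> f = \<one> (Dom C f)"
    and Comp_inv: "f \<cdot> inv f = \<one> (Cod C f)"
  using inverse_arrows_inv[OF assms] by (auto simp: inverse_arrows_def Hom_def)

lemma inv_Comp_assoc: "\<lbrakk>iso C f; k \<in> Arr C; Cod C k = Dom C f\<rbrakk> \<Longrightarrow> inv f \<cdot> (f \<cdot> k) = k"
  by (subst Comp_reassoc[OF inv_Comp]) (auto simp: iso_arr inv_arr Cod_obj)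

lemma Comp_inv_assoc: "\<lbrakk>iso C f; k \<in> Arr C; Cod C k = Cod C f\<rbrakk> \<Longrightarrow> f \<cdot> (inv f \<cdot> k) = k"
  by (subst Comp_reassoc[OF Comp_inv]) (auto simp: iso_arr inv_arr Cod_obj)

lemma iso_cancel_left:
  assumes "iso C h" "h \<cdot> f = h \<cdot> g" "f \<in> Arr C" "g \<in> Arr C" "Cod C f = Dom C h" "Cod C g = Dom C h"
  shows "f = g"
  using assms by (metis inv_Comp_assoc)

lemma iso_cancel_right:
  assumes "iso C h" "f \<cdot> h = g \<cdot> h" "f \<in> Arr C" "g \<in> Arr C" "Dom C f = Cod C h" "Dom C g = Cod C h"
  shows "f = g"
proof -
  have "(f \<cdot> h) \<cdot> inv h = (g \<cdot> h) \<cdot> inv h"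
    using assms(2) by simp
  then show ?thesis
    using assms(1,3-) by (simp add: iso_arr inv_arr Comp_inv)
qed

end

section \<open>Coherence isomorphisms of a monoidal category\<close>

context monoidal_category
begin

declare Tobj_obj [simp] Unit_obj [simp] Tarr_Id [simp]

lemma Tarr_arr [simp]:
  assumes "f \<in> Arr C" "g \<in> Arr C"
  shows "f \<otimes> g \<in> Arr C" "Dom C (f \<otimes> g) = Dom C f \<odot> Dom C g" "Cod C (f \<otimes> g) = Cod C f \<odot> Cod C g"
  using Tarr_hom[of f "Dom C f" "Cod C f" g "Dom C g" "Cod C g"] assms by (auto simp: Hom_def)

lemma Tarr_Comp_arr:
  assumes "f \<in> Arr C" "g \<in> Arr C" "Cod C f = Dom C g" "f' \<in> Arr C" "g' \<in> Arr C" "Cod C f' = Dom C g'"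
  shows "(g \<otimes> g') \<cdot> (f \<otimes> f') = (g \<cdot> f) \<otimes> (g' \<cdot> f')"
  using assms by (intro Tarr_Comp[symmetric]) auto

lemma whisker_left [simp]:
  assumes "f \<in> Arr C" "g \<in> Arr C" "Cod C f = Dom C g" "A \<in> Obj C"
  shows "\<one> A \<otimes> (g \<cdot> f) = (\<one> A \<otimes> g) \<cdot> (\<one> A \<otimes> f)"
  using assms by (simp add: Tarr_Comp_arr)

lemma whisker_right [simp]:
  assumes "f \<in> Arr C" "g \<in> Arr C" "Cod C f = Dom C g" "A \<in> Obj C"
  shows "(g \<cdot> f) \<otimes> \<one> A = (g \<otimes> \<one> A) \<cdot> (f \<otimes> \<one> A)"
  using assms by (simp add: Tarr_Comp_arr)

lemma Tarr_split:
  assumes "f \<in> Arr C" "g \<in> Arr C"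
  shows "f \<otimes> g = (\<one> (Cod C f) \<otimes> g) \<cdot> (f \<otimes> \<one> (Dom C g))"
  using assms by (simp add: Tarr_Comp_arr Cod_obj Dom_obj)

lemma interchange:
  assumes "f \<in> Arr C" "g \<in> Arr C" "A = Dom C f" "B = Cod C g" "A' = Cod C f" "B' = Dom C g"
  shows "(f \<otimes> \<one> B) \<cdot> (\<one> A \<otimes> g) = (\<one> A' \<otimes> g) \<cdot> (f \<otimes> \<one> B')"
  using assms by (simp add: Tarr_Comp_arr Cod_obj Dom_obj)

lemma Assoc_arr [simp]:
  assumes "A \<in> Obj C" "B \<in> Obj C" "D \<in> Obj C"
  shows "\<alpha> A B D \<in> Arr C" "Dom C (\<alpha> A B D) = (A \<odot> B) \<odot> D" "Cod C (\<alpha> A B D) = A \<odot> (B \<odot> D)"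
  using Assoc_hom[OF assms] by (auto simp: Hom_def)

lemma Lunit_arr [simp]:
  assumes "A \<in> Obj C"
  shows "\<ll> A \<in> Arr C" "Dom C (\<ll> A) = \<K> \<odot> A" "Cod C (\<ll> A) = A"
  using Lunit_hom[OF assms] by (auto simp: Hom_def)

lemma Runit_arr [simp]:
  assumes "A \<in> Obj C"
  shows "\<rr> A \<in> Arr C" "Dom C (\<rr> A) = A \<odot> \<K>" "Cod C (\<rr> A) = A"
  using Runit_hom[OF assms] by (auto simp: Hom_def)

lemma inv_Assoc [simp]:
  assumes "A \<in> Obj C" "B \<in> Obj C" "D \<in> Obj C"
  shows "inv (\<alpha> A B D) \<in> Arr C" "Dom C (inv (\<alpha> A B D)) = A \<odot> (B \<odot> D)"
    "Cod C (inv (\<alpha> A B D)) = (A \<odot> B) \<odot> D"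
    "inv (\<alpha> A B D) \<cdot> \<alpha> A B D = \<one> ((A \<odot> B) \<odot> D)"
    "\<alpha> A B D \<cdot> inv (\<alpha> A B D) = \<one> (A \<odot> (B \<odot> D))"
    "\<lbrakk>k \<in> Arr C; Cod C k = (A \<odot> B) \<odot> D\<rbrakk> \<Longrightarrow> inv (\<alpha> A B D) \<cdot> (\<alpha> A B D \<cdot> k) = k"
    "\<lbrakk>k \<in> Arr C; Cod C k = A \<odot> (B \<odot> D)\<rbrakk> \<Longrightarrow> \<alpha> A B D \<cdot> (inv (\<alpha> A B D) \<cdot> k) = k"
  using assms Assoc_iso[OF assms]
  by (auto simp: inv_arr inv_Comp Comp_inv inv_Comp_assoc Comp_inv_assoc)

lemma inv_Lunit [simp]:
  assumes "A \<in> Obj C"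
  shows "inv (\<ll> A) \<in> Arr C" "Dom C (inv (\<ll> A)) = A" "Cod C (inv (\<ll> A)) = \<K> \<odot> A"
    "inv (\<ll> A) \<cdot> \<ll> A = \<one> (\<K> \<odot> A)" "\<ll> A \<cdot> inv (\<ll> A) = \<one> A"
    "\<lbrakk>k \<in> Arr C; Cod C k = \<K> \<odot> A\<rbrakk> \<Longrightarrow> inv (\<ll> A) \<cdot> (\<ll> A \<cdot> k) = k"
    "\<lbrakk>k \<in> Arr C; Cod C k = A\<rbrakk> \<Longrightarrow> \<ll> A \<cdot> (inv (\<ll> A) \<cdot> k) = k"
  using assms Lunit_iso[OF assms]
  by (auto simp: inv_arr inv_Comp Comp_inv inv_Comp_assoc Comp_inv_assoc)

lemma inv_Runit [simp]:
  assumes "A \<in> Obj C"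
  shows "inv (\<rr> A) \<in> Arr C" "Dom C (inv (\<rr> A)) = A" "Cod C (inv (\<rr> A)) = A \<odot> \<K>"
    "inv (\<rr> A) \<cdot> \<rr> A = \<one> (A \<odot> \<K>)" "\<rr> A \<cdot> inv (\<rr> A) = \<one> A"
    "\<lbrakk>k \<in> Arr C; Cod C k = A \<odot> \<K>\<rbrakk> \<Longrightarrow> inv (\<rr> A) \<cdot> (\<rr> A \<cdot> k) = k"
    "\<lbrakk>k \<in> Arr C; Cod C k = A\<rbrakk> \<Longrightarrow> \<rr> A \<cdot> (inv (\<rr> A) \<cdot> k) = k"
  using assms Runit_iso[OF assms]
  by (auto simp: inv_arr inv_Comp Comp_inv inv_Comp_assoc Comp_inv_assoc)

text \<open>The simp rules \<open>whisker_left\<close> and \<open>whisker_right\<close> split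
  whiskered composites and thereby hide \<open>g \<cdot> f\<close>. This lemma and the next carry an
  equation over to the split form.\<close>

lemma whisker_left_eq:
  assumes "g \<cdot> f = h" "f \<in> Arr C" "g \<in> Arr C" "Cod C f = Dom C g" "A \<in> Obj C"
  shows "(\<one> A \<otimes> g) \<cdot> (\<one> A \<otimes> f) = \<one> A \<otimes> h"
  using assms by auto

lemma whisker_right_eq:
  assumes "g \<cdot> f = h" "f \<in> Arr C" "g \<in> Arr C" "Cod C f = Dom C g" "A \<in> Obj C"
  shows "(g \<otimes> \<one> A) \<cdot> (f \<otimes> \<one> A) = h \<otimes> \<one> A"
  using assms by auto

lemma iso_I:
  assumes "f \<in> Arr C" "g \<in> Arr C" "Dom C g = Cod C f" "Cod C g = Dom C f"
    "g \<cdot> f = \<one> (Dom C f)" "f \<cdot> g = \<one> (Cod C f)"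
  shows "iso C f"
  using assms by (auto simp: iso_def inverse_arrows_def)

lemma iso_whisker_right: "\<lbrakk>iso C f; A \<in> Obj C\<rbrakk> \<Longrightarrow> iso C (f \<otimes> \<one> A)"
  by (rule iso_I[where g = "inv f \<otimes> \<one> A"])
    (simp_all add: iso_arr inv_arr Comp_inv inv_Comp Dom_obj Cod_obj flip: whisker_right)

lemma iso_whisker_left: "\<lbrakk>iso C f; A \<in> Obj C\<rbrakk> \<Longrightarrow> iso C (\<one> A \<otimes> f)"
  by (rule iso_I[where g = "\<one> A \<otimes> inv f"])
    (simp_all add: iso_arr inv_arr Comp_inv inv_Comp Dom_obj Cod_obj flip: whisker_left)

lemma iso_Comp: "\<lbrakk>iso C f; iso C g; Cod C f = Dom C g\<rbrakk> \<Longrightarrow> iso C (g \<cdot> f)"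
  by (rule iso_I[where g = "inv f \<cdot> inv g"])
    (simp_all add: iso_arr inv_arr Comp_inv inv_Comp Comp_inv_assoc inv_Comp_assoc)

lemma iso_inv: "iso C f \<Longrightarrow> iso C (inv f)"
  by (rule iso_I[where g = f]) (simp_all add: iso_arr inv_arr Comp_inv inv_Comp)

lemma Assoc_natural_arr:
  assumes "f \<in> Arr C" "g \<in> Arr C" "h \<in> Arr C"
  shows "\<alpha> (Cod C f) (Cod C g) (Cod C h) \<cdot> ((f \<otimes> g) \<otimes> h)
    = (f \<otimes> (g \<otimes> h)) \<cdot> \<alpha> (Dom C f) (Dom C g) (Dom C h)"
  using assms by (intro Assoc_natural) auto

text \<open>By naturality of \<open>\<ll>\<close> the whiskered arrows determine
  \<open>f \<cdot> \<ll> A\<close> and \<open>g \<cdot> \<ll> A\<close>, and \<open>\<ll> A\<close>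
  is invertible.\<close>

lemma whisker_left_faithful:
  assumes "\<one> \<K> \<otimes> f = \<one> \<K> \<otimes> g" "f \<in> Hom C A B" "g \<in> Hom C A B"
  shows "f = g"
proof -
  have "f \<cdot> \<ll> A = g \<cdot> \<ll> A"
    using assms(1) Lunit_natural[OF assms(2)] Lunit_natural[OF assms(3)] by simp
  then show ?thesis
    using assms Hom_obj[OF assms(2)] Lunit_iso by - (rule iso_cancel_right[of "\<ll> A"], auto simp: Hom_def)
qed

text \<open>This recovers an equation from its tailed form: the tail \<open>\<K>\<close> alone
  suffices.\<close>

lemma whisker_right_faithful:
  assumes "f \<otimes> \<one> \<K> = g \<otimes> \<one> \<K>" "f \<in> Hom C A B" "g \<in> Hom C A B"
  shows "f = g"
proof -
  have "f \<cdot> \<rr> A = g \<cdot> \<rr> A"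
    using assms(1) Runit_natural[OF assms(2)] Runit_natural[OF assms(3)] by simp
  then show ?thesis
    using assms Hom_obj[OF assms(2)] Runit_iso by - (rule iso_cancel_right[of "\<rr> A"], auto simp: Hom_def)
qed

text \<open>Kelly's derivation from pentagon and triangle: tensor with \<open>\<one> \<K>\<close> on
  the left, precompose with the invertible \<open>?h\<close>, and compare the two paths around the
  pentagon for \<open>\<K>\<close>, \<open>\<K>\<close>, \<open>A\<close>, \<open>B\<close>.
  Faithfulness then removes the extra factor \<open>\<K>\<close>.\<close>

lemma Lunit_Tobj:
  assumes [simp]: "A \<in> Obj C" "B \<in> Obj C"
  shows "\<ll> (A \<odot> B) \<cdot> \<alpha> \<K> A B = \<ll> A \<otimes> \<one> B"
proof -
  let ?h = "\<alpha> \<K> (\<K> \<odot> A) B \<cdot> (\<alpha> \<K> \<K> A \<otimes> \<one> B)"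
  have "(\<one> \<K> \<otimes> (\<ll> (A \<odot> B) \<cdot> \<alpha> \<K> A B)) \<cdot> ?h
    = (\<one> \<K> \<otimes> \<ll> (A \<odot> B)) \<cdot> ((\<one> \<K> \<otimes> \<alpha> \<K> A B) \<cdot> \<alpha> \<K> (\<K> \<odot> A) B \<cdot> (\<alpha> \<K> \<K> A \<otimes> \<one> B))"
    by simp
  also have "\<dots> = ((\<one> \<K> \<otimes> \<ll> (A \<odot> B)) \<cdot> \<alpha> \<K> \<K> (A \<odot> B)) \<cdot> \<alpha> (\<K> \<odot> \<K>) A B"
    by (subst pentagon) simp_all
  also have "\<dots> = (\<rr> \<K> \<otimes> (\<one> A \<otimes> \<one> B)) \<cdot> \<alpha> (\<K> \<odot> \<K>) A B"
    by (subst triangle) simp_all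
  also have "\<dots> = \<alpha> \<K> A B \<cdot> ((\<rr> \<K> \<otimes> \<one> A) \<otimes> \<one> B)"
    using Assoc_natural_arr[of "\<rr> \<K>" "\<one> A" "\<one> B"] by (simp del: Tarr_Id)
  also have "\<dots> = (\<alpha> \<K> A B \<cdot> ((\<one> \<K> \<otimes> \<ll> A) \<otimes> \<one> B)) \<cdot> (\<alpha> \<K> \<K> A \<otimes> \<one> B)"
    by (subst triangle[symmetric]) simp_all
  also have "\<dots> = (\<one> \<K> \<otimes> (\<ll> A \<otimes> \<one> B)) \<cdot> ?h"
    using Assoc_natural_arr[of "\<one> \<K>" "\<ll> A" "\<one> B"] by simp
  finally have "\<one> \<K> \<otimes> (\<ll> (A \<odot> B) \<cdot> \<alpha> \<K> A B) = \<one> \<K> \<otimes> (\<ll> A \<otimes> \<one> B)"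
    by (rule iso_cancel_right[rotated])
      (auto intro!: iso_Comp iso_whisker_right Assoc_iso simp del: whisker_left)
  then show ?thesis
    by (rule whisker_left_faithful) auto
qed

text \<open>Associator naturality, solved so that rewriting moves the tail \<open>Z\<close> to the
  innermost right position. The lemmas up to \<open>inv_Runit_Id_right\<close> do this for the other
  shapes; where a coherence isomorphism is whiskered, they use pentagon, triangle or
  \<open>Lunit_Tobj\<close> instead.\<close>

lemma Tarr_Id_right_Id_right:
  assumes "f \<in> Arr C" "B \<in> Obj C" "Z \<in> Obj C"
  shows "(f \<otimes> \<one> B) \<otimes> \<one> Z = inv (\<alpha> (Cod C f) B Z) \<cdot> (f \<otimes> \<one> (B \<odot> Z)) \<cdot> \<alpha> (Dom C f) B Z"
  using assms Assoc_natural_arr[of f "\<one> B" "\<one> Z"]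
  by - (rule iso_cancel_left[OF Assoc_iso, of "Cod C f" B Z], simp_all add: Dom_obj Cod_obj)

lemma Tarr_Id_left_Id_right:
  assumes "f \<in> Arr C" "A \<in> Obj C" "Z \<in> Obj C"
  shows "(\<one> A \<otimes> f) \<otimes> \<one> Z = inv (\<alpha> A (Cod C f) Z) \<cdot> (\<one> A \<otimes> (f \<otimes> \<one> Z)) \<cdot> \<alpha> A (Dom C f) Z"
  using assms Assoc_natural_arr[of "\<one> A" f "\<one> Z"]
  by - (rule iso_cancel_left[OF Assoc_iso, of A "Cod C f" Z], simp_all add: Dom_obj Cod_obj)

lemma Tarr_Id_Tobj_left:
  assumes "f \<in> Arr C" "A \<in> Obj C" "B \<in> Obj C"
  shows "\<one> (A \<odot> B) \<otimes> f = inv (\<alpha> A B (Cod C f)) \<cdot> (\<one> A \<otimes> (\<one> B \<otimes> f)) \<cdot> \<alpha> A B (Dom C f)"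
  using assms Assoc_natural_arr[of "\<one> A" "\<one> B" f]
  by - (rule iso_cancel_left[OF Assoc_iso, of A B "Cod C f"], simp_all add: Dom_obj Cod_obj)

lemma Assoc_Id_right:
  assumes [simp]: "A \<in> Obj C" "B \<in> Obj C" "D \<in> Obj C" "Z \<in> Obj C"
  shows "\<alpha> A B D \<otimes> \<one> Z
    = inv (\<alpha> A (B \<odot> D) Z) \<cdot> (\<one> A \<otimes> inv (\<alpha> B D Z)) \<cdot> \<alpha> A B (D \<odot> Z) \<cdot> \<alpha> (A \<odot> B) D Z"
  by (simp add: Comp_reassoc[OF whisker_left_eq[OF inv_Assoc(4)]] flip: pentagon)

lemma inv_Assoc_Id_right:
  assumes [simp]: "A \<in> Obj C" "B \<in> Obj C" "D \<in> Obj C" "Z \<in> Obj C"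
  shows "inv (\<alpha> A B D) \<otimes> \<one> Z
    = inv (\<alpha> (A \<odot> B) D Z) \<cdot> inv (\<alpha> A B (D \<odot> Z)) \<cdot> (\<one> A \<otimes> \<alpha> B D Z) \<cdot> \<alpha> A (B \<odot> D) Z"
proof (rule iso_cancel_left)
  show "iso C (\<alpha> A B D \<otimes> \<one> Z)"
    by (simp add: iso_whisker_right Assoc_iso)
  show "(\<alpha> A B D \<otimes> \<one> Z) \<cdot> (inv (\<alpha> A B D) \<otimes> \<one> Z) = (\<alpha> A B D \<otimes> \<one> Z) \<cdot>
    (inv (\<alpha> (A \<odot> B) D Z) \<cdot> inv (\<alpha> A B (D \<odot> Z)) \<cdot> (\<one> A \<otimes> \<alpha> B D Z) \<cdot> \<alpha> A (B \<odot> D) Z)"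
    by (subst whisker_right_eq[OF inv_Assoc(5)])
      (simp_all add: Assoc_Id_right Comp_reassoc[OF whisker_left_eq[OF inv_Assoc(4)]])
qed simp_all

lemma Lunit_Id_right:
  assumes [simp]: "A \<in> Obj C" "B \<in> Obj C"
  shows "\<ll> A \<otimes> \<one> B = \<ll> (A \<odot> B) \<cdot> \<alpha> \<K> A B"
  by (simp add: Lunit_Tobj)

lemma inv_Lunit_Id_right:
  assumes [simp]: "A \<in> Obj C" "B \<in> Obj C"
  shows "inv (\<ll> A) \<otimes> \<one> B = inv (\<alpha> \<K> A B) \<cdot> inv (\<ll> (A \<odot> B))"
proof (rule iso_cancel_left)
  show "(\<ll> A \<otimes> \<one> B) \<cdot> (inv (\<ll> A) \<otimes> \<one> B) = (\<ll> A \<otimes> \<one> B) \<cdot> (inv (\<alpha> \<K> A B) \<cdot> inv (\<ll> (A \<odot> B)))"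
    by (subst whisker_right_eq[OF inv_Lunit(5)]) (simp_all add: Lunit_Id_right)
qed (simp_all add: iso_whisker_right Lunit_iso)

lemma Runit_Id_right:
  assumes [simp]: "A \<in> Obj C" "B \<in> Obj C"
  shows "\<rr> A \<otimes> \<one> B = (\<one> A \<otimes> \<ll> B) \<cdot> \<alpha> A \<K> B"
  by (simp add: triangle)

lemma inv_Runit_Id_right:
  assumes [simp]: "A \<in> Obj C" "B \<in> Obj C"
  shows "inv (\<rr> A) \<otimes> \<one> B = inv (\<alpha> A \<K> B) \<cdot> (\<one> A \<otimes> inv (\<ll> B))"
proof (rule iso_cancel_left)
  show "(\<rr> A \<otimes> \<one> B) \<cdot> (inv (\<rr> A) \<otimes> \<one> B) = (\<rr> A \<otimes> \<one> B) \<cdot> (inv (\<alpha> A \<K> B) \<cdot> (\<one> A \<otimes> inv (\<ll> B)))"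
    by (subst whisker_right_eq[OF inv_Runit(5)])
      (simp_all add: Runit_Id_right whisker_left_eq[OF inv_Lunit(5)])
qed (simp_all add: iso_whisker_right Runit_iso)

lemma Lunit_natural_arr:
  assumes "f \<in> Arr C" "Cod C f = B"
  shows "\<ll> B \<cdot> (\<one> \<K> \<otimes> f) = f \<cdot> \<ll> (Dom C f)"
  using assms by (intro Lunit_natural) auto

lemma inv_Lunit_natural_arr:
  assumes "f \<in> Arr C" "Cod C f = B"
  shows "inv (\<ll> B) \<cdot> f = (\<one> \<K> \<otimes> f) \<cdot> inv (\<ll> (Dom C f))"
proof (rule iso_cancel_left)
  show "iso C (\<ll> B)" "Cod C (inv (\<ll> B) \<cdot> f) = Dom C (\<ll> B)" "inv (\<ll> B) \<cdot> f \<in> Arr C"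
    "Cod C ((\<one> \<K> \<otimes> f) \<cdot> inv (\<ll> (Dom C f))) = Dom C (\<ll> B)" "(\<one> \<K> \<otimes> f) \<cdot> inv (\<ll> (Dom C f)) \<in> Arr C"
    using assms Lunit_iso Dom_obj Cod_obj by auto
  show "\<ll> B \<cdot> (inv (\<ll> B) \<cdot> f) = \<ll> B \<cdot> ((\<one> \<K> \<otimes> f) \<cdot> inv (\<ll> (Dom C f)))"
    using assms Cod_obj[of f] Dom_obj[of f] by (simp add: Comp_reassoc[OF Lunit_natural_arr])
qed

text \<open>A normalizer for coherence: structured arrows tensored with a tail are expanded into
  right-bracketed ones, and adjacent inverse pairs cancel, also below a left whiskering.\<close>

lemmas tail_simps = Tarr_Id_right_Id_right Tarr_Id_left_Id_right Tarr_Id_Tobj_left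
  Assoc_Id_right inv_Assoc_Id_right Lunit_Id_right inv_Lunit_Id_right Runit_Id_right inv_Runit_Id_right
  Comp_reassoc[OF whisker_left_eq[OF inv_Assoc(4)]] Comp_reassoc[OF whisker_left_eq[OF inv_Assoc(5)]]
  whisker_left_eq[OF inv_Assoc(4)] whisker_left_eq[OF inv_Assoc(5)]
  Comp_reassoc[OF whisker_left_eq[OF inv_Lunit(4)]] Comp_reassoc[OF whisker_left_eq[OF inv_Lunit(5)]]
  whisker_left_eq[OF inv_Lunit(4)] whisker_left_eq[OF inv_Lunit(5)]

subsection \<open>Morphisms with a tail\<close>

text \<open>\<open>tmul\<close>, \<open>tcom\<close>, \<open>tuni\<close>, \<open>tcou\<close>: right-bracketed versions of
  \<open>f \<otimes> 1\<^sub>Z\<close> for \<open>f\<close> shaped like a multiplication, comultiplication, unit, counit.\<close>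

definition tmul :: "'b \<Rightarrow> 'a \<Rightarrow> 'a \<Rightarrow> 'a \<Rightarrow> 'b"
  where "tmul f A B Z = (f \<otimes> \<one> Z) \<cdot> inv (\<alpha> A B Z)"

definition tcom :: "'b \<Rightarrow> 'a \<Rightarrow> 'a \<Rightarrow> 'a \<Rightarrow> 'b"
  where "tcom f A B Z = \<alpha> A B Z \<cdot> (f \<otimes> \<one> Z)"

definition tuni :: "'b \<Rightarrow> 'a \<Rightarrow> 'b"
  where "tuni f Z = (f \<otimes> \<one> Z) \<cdot> inv (\<ll> Z)"

definition tcou :: "'b \<Rightarrow> 'a \<Rightarrow> 'b"
  where "tcou f Z = \<ll> Z \<cdot> (f \<otimes> \<one> Z)"

section \<open>Tailed morphisms: naturality in the tail and translation of equations\<close>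

lemma tmul_arr:
  assumes "f \<in> Hom C (A \<odot> B) D" "A \<in> Obj C" "B \<in> Obj C" "Z \<in> Obj C"
  shows "tmul f A B Z \<in> Arr C" "Dom C (tmul f A B Z) = A \<odot> (B \<odot> Z)" "Cod C (tmul f A B Z) = D \<odot> Z"
  using assms by (auto simp: tmul_def Hom_def)

lemma tcom_arr:
  assumes "f \<in> Hom C D (A \<odot> B)" "A \<in> Obj C" "B \<in> Obj C" "Z \<in> Obj C"
  shows "tcom f A B Z \<in> Arr C" "Dom C (tcom f A B Z) = D \<odot> Z" "Cod C (tcom f A B Z) = A \<odot> (B \<odot> Z)"
  using assms by (auto simp: tcom_def Hom_def)

lemma tuni_arr:
  assumes "f \<in> Hom C \<K> A" "Z \<in> Obj C"
  shows "tuni f Z \<in> Arr C" "Dom C (tuni f Z) = Z" "Cod C (tuni f Z) = A \<odot> Z"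
  using assms by (auto simp: tuni_def Hom_def)

lemma tcou_arr:
  assumes "f \<in> Hom C A \<K>" "Z \<in> Obj C"
  shows "tcou f Z \<in> Arr C" "Dom C (tcou f Z) = A \<odot> Z" "Cod C (tcou f Z) = Z"
  using assms by (auto simp: tcou_def Hom_def)

text \<open>Here and in the next three lemmas interchange slides \<open>h\<close> past
  \<open>f\<close>; naturality of the associators or unitors does the rest.\<close>

lemma tmul_natural:
  assumes "f \<in> Hom C (A \<odot> B) D" "A \<in> Obj C" "B \<in> Obj C" "h \<in> Arr C" "Cod C h = Z'" "Dom C h = Z"
  shows "tmul f A B Z' \<cdot> (\<one> A \<otimes> (\<one> B \<otimes> h)) = (\<one> D \<otimes> h) \<cdot> tmul f A B Z"
proof -
  have eq: "(\<one> D \<otimes> h) \<cdot> (f \<otimes> \<one> Z) = (f \<otimes> \<one> Z') \<cdot> (\<one> (A \<odot> B) \<otimes> h)"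
    using assms by (intro interchange[symmetric]) (auto simp: Hom_def)
  have obj: "Z \<in> Obj C" "Z' \<in> Obj C" "D \<in> Obj C"
    using assms Dom_obj Cod_obj by (auto simp: Hom_def)
  show ?thesis
    using assms obj by (simp add: tmul_def tail_simps eq Hom_def Comp_reassoc[OF eq])
qed

lemma tcom_natural:
  assumes "f \<in> Hom C D (A \<odot> B)" "A \<in> Obj C" "B \<in> Obj C" "h \<in> Arr C" "Cod C h = Z'" "Dom C h = Z"
  shows "tcom f A B Z' \<cdot> (\<one> D \<otimes> h) = (\<one> A \<otimes> (\<one> B \<otimes> h)) \<cdot> tcom f A B Z"
proof -
  have eq: "(f \<otimes> \<one> Z') \<cdot> (\<one> D \<otimes> h) = (\<one> (A \<odot> B) \<otimes> h) \<cdot> (f \<otimes> \<one> Z)"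
    using assms by (intro interchange) (auto simp: Hom_def)
  have obj: "Z \<in> Obj C" "Z' \<in> Obj C" "D \<in> Obj C"
    using assms Dom_obj Cod_obj by (auto simp: Hom_def)
  show ?thesis
    using assms obj by (simp add: tcom_def tail_simps eq Hom_def Comp_reassoc[OF eq])
qed

lemma tuni_natural:
  assumes "f \<in> Hom C \<K> A" "h \<in> Arr C" "Cod C h = Z'" "Dom C h = Z"
  shows "tuni f Z' \<cdot> h = (\<one> A \<otimes> h) \<cdot> tuni f Z"
proof -
  have eq: "(f \<otimes> \<one> Z') \<cdot> (\<one> \<K> \<otimes> h) = (\<one> A \<otimes> h) \<cdot> (f \<otimes> \<one> Z)"
    using assms by (intro interchange) (auto simp: Hom_def)
  have obj: "Z \<in> Obj C" "Z' \<in> Obj C" "A \<in> Obj C"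
    using assms Dom_obj Cod_obj by (auto simp: Hom_def)
  show ?thesis
    using assms obj by (simp add: tuni_def inv_Lunit_natural_arr eq Hom_def Comp_reassoc[OF eq])
qed

lemma tcou_natural:
  assumes "f \<in> Hom C A \<K>" "h \<in> Arr C" "Cod C h = Z'" "Dom C h = Z"
  shows "tcou f Z' \<cdot> (\<one> A \<otimes> h) = h \<cdot> tcou f Z"
proof -
  have eq: "(f \<otimes> \<one> Z') \<cdot> (\<one> A \<otimes> h) = (\<one> \<K> \<otimes> h) \<cdot> (f \<otimes> \<one> Z)"
    using assms by (intro interchange) (auto simp: Hom_def)
  have obj: "Z \<in> Obj C" "Z' \<in> Obj C" "A \<in> Obj C"
    using assms Dom_obj Cod_obj by (auto simp: Hom_def)
  show ?thesis
    using assms obj by (simp add: tcou_def Comp_reassoc[OF Lunit_natural_arr] eq Hom_def Comp_reassoc[OF eq])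
qed

text \<open>The pattern for translating an axiom: tensor the bracketed equation with
  \<open>\<one> Z\<close>, compose with a coherence isomorphism \<open>?w\<close>, and normalize
  both sides. All associators are absorbed.\<close>

lemma tmul_assoc:
  assumes f: "f \<in> Hom C (A \<odot> B) P" and g: "g \<in> Hom C (P \<odot> D) Q"
    and h: "h \<in> Hom C (B \<odot> D) R" and k: "k \<in> Hom C (A \<odot> R) Q"
    and [simp]: "A \<in> Obj C" "B \<in> Obj C" "D \<in> Obj C" "Z \<in> Obj C"
    and eq: "g \<cdot> (f \<otimes> \<one> D) = k \<cdot> (\<one> A \<otimes> h) \<cdot> \<alpha> A B D"
  shows "tmul g P D Z \<cdot> tmul f A B (D \<odot> Z) = tmul k A R Z \<cdot> (\<one> A \<otimes> tmul h B D Z)"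
proof -
  note [simp] = f[THEN Hom_arr] g[THEN Hom_arr] h[THEN Hom_arr] k[THEN Hom_arr]
    f[THEN Hom_obj] h[THEN Hom_obj] g[THEN Hom_obj]
  let ?w = "inv (\<alpha> (A \<odot> B) D Z) \<cdot> inv (\<alpha> A B (D \<odot> Z))"
  have "tmul g P D Z \<cdot> tmul f A B (D \<odot> Z) = ((g \<cdot> (f \<otimes> \<one> D)) \<otimes> \<one> Z) \<cdot> ?w"
    by (simp add: tmul_def tail_simps)
  also have "\<dots> = ((k \<cdot> (\<one> A \<otimes> h) \<cdot> \<alpha> A B D) \<otimes> \<one> Z) \<cdot> ?w"
    by (simp only: eq)
  also have "\<dots> = tmul k A R Z \<cdot> (\<one> A \<otimes> tmul h B D Z)"
    by (simp add: tmul_def tail_simps)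
  finally show ?thesis .
qed

lemma tcom_coassoc:
  assumes f: "f \<in> Hom C A (A \<odot> A)" and [simp]: "Z \<in> Obj C"
    and eq: "\<alpha> A A A \<cdot> (f \<otimes> \<one> A) \<cdot> f = (\<one> A \<otimes> f) \<cdot> f"
  shows "tcom f A A (A \<odot> Z) \<cdot> tcom f A A Z = (\<one> A \<otimes> tcom f A A Z) \<cdot> tcom f A A Z"
proof -
  note [simp] = f[THEN Hom_arr] f[THEN Hom_obj]
  let ?w = "(\<one> A \<otimes> \<alpha> A A Z) \<cdot> \<alpha> A (A \<odot> A) Z"
  have "tcom f A A (A \<odot> Z) \<cdot> tcom f A A Z = ?w \<cdot> ((\<alpha> A A A \<cdot> (f \<otimes> \<one> A) \<cdot> f) \<otimes> \<one> Z)"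
    by (simp add: tcom_def tail_simps)
  also have "\<dots> = ?w \<cdot> (((\<one> A \<otimes> f) \<cdot> f) \<otimes> \<one> Z)"
    by (simp only: eq)
  also have "\<dots> = (\<one> A \<otimes> tcom f A A Z) \<cdot> tcom f A A Z"
    by (simp add: tcom_def tail_simps)
  finally show ?thesis .
qed

text \<open>This and the following composition rules say that composing tailed arrows amounts to
  putting a tail on the composite. They serve to translate unit, counit and integral equations,
  whose unitors are absorbed.\<close>

lemma tcou_tcom_left:
  assumes "f \<in> Hom C A (B \<odot> D)" "g \<in> Hom C B \<K>" "D \<in> Obj C" "Z \<in> Obj C"
  shows "tcou g (D \<odot> Z) \<cdot> tcom f B D Z = (\<ll> D \<cdot> (g \<otimes> \<one> D) \<cdot> f) \<otimes> \<one> Z"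
  using assms assms(1,2)[THEN Hom_obj] by (simp add: Hom_def tcom_def tcou_def tail_simps)

lemma tcou_tcom_right:
  assumes "f \<in> Hom C A (B \<odot> D)" "g \<in> Hom C D \<K>" "B \<in> Obj C" "Z \<in> Obj C"
  shows "(\<one> B \<otimes> tcou g Z) \<cdot> tcom f B D Z = (\<rr> B \<cdot> (\<one> B \<otimes> g) \<cdot> f) \<otimes> \<one> Z"
  using assms assms(1,2)[THEN Hom_obj] by (simp add: Hom_def tcom_def tcou_def tail_simps)

lemma tmul_tuni_left:
  assumes "f \<in> Hom C (A \<odot> B) D" "g \<in> Hom C \<K> A" "B \<in> Obj C" "Z \<in> Obj C"
  shows "tmul f A B Z \<cdot> tuni g (B \<odot> Z) = (f \<cdot> (g \<otimes> \<one> B) \<cdot> inv (\<ll> B)) \<otimes> \<one> Z"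
  using assms assms(1,2)[THEN Hom_obj] by (simp add: Hom_def tmul_def tuni_def tail_simps)

lemma tmul_tuni_right:
  assumes "f \<in> Hom C (A \<odot> B) D" "g \<in> Hom C \<K> B" "A \<in> Obj C" "Z \<in> Obj C"
  shows "tmul f A B Z \<cdot> (\<one> A \<otimes> tuni g Z) = (f \<cdot> (\<one> A \<otimes> g) \<cdot> inv (\<rr> A)) \<otimes> \<one> Z"
  using assms assms(1,2)[THEN Hom_obj] by (simp add: Hom_def tmul_def tuni_def tail_simps)

lemma tuni_tcou:
  assumes "f \<in> Hom C A \<K>" "g \<in> Hom C \<K> B" "Z \<in> Obj C"
  shows "tuni g Z \<cdot> tcou f Z = (g \<cdot> f) \<otimes> \<one> Z"
  using assms assms(1,2)[THEN Hom_obj] by (simp add: Hom_def tcou_def tuni_def)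

lemma tcou_tuni:
  assumes "f \<in> Hom C A \<K>" "g \<in> Hom C \<K> A" "Z \<in> Obj C" "f \<cdot> g = \<one> \<K>"
  shows "tcou f Z \<cdot> tuni g Z = \<one> Z"
  using assms assms(1,2)[THEN Hom_obj]
  by (simp add: Hom_def tcou_def tuni_def Comp_reassoc[OF whisker_right_eq[OF assms(4)]])

lemma tcou_tmul:
  assumes "f \<in> Hom C (A \<odot> B) D" "g \<in> Hom C A \<K>" "g' \<in> Hom C B \<K>" "k \<in> Hom C D \<K>"
    and [simp]: "Z \<in> Obj C"
    and eq: "k \<cdot> f = \<ll> \<K> \<cdot> (g \<otimes> g')"
  shows "tcou k Z \<cdot> tmul f A B Z = tcou g' Z \<cdot> tcou g (B \<odot> Z)"
proof -
  note [simp] = assms(1-4)[THEN Hom_arr] assms(1-4)[THEN Hom_obj]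
  have "tcou k Z \<cdot> tmul f A B Z = \<ll> Z \<cdot> ((k \<cdot> f) \<otimes> \<one> Z) \<cdot> inv (\<alpha> A B Z)"
    by (simp add: tcou_def tmul_def)
  \<comment> \<open>The tensor counit is made sequential, first \<open>g\<close> on the left factor
    and then \<open>g'\<close> on the right one, so that each can become a tailed counit.\<close>
  also have "\<dots> = \<ll> Z \<cdot> ((\<ll> \<K> \<cdot> (\<one> \<K> \<otimes> g') \<cdot> (g \<otimes> \<one> B)) \<otimes> \<one> Z) \<cdot> inv (\<alpha> A B Z)"
    by (simp only: eq) (subst Tarr_split[of g g'], simp_all)
  also have "\<dots> = tcou g' Z \<cdot> tcou g (B \<odot> Z)"
    by (simp add: tcou_def tail_simps Comp_reassoc[OF Lunit_natural_arr])
  finally show ?thesis .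
qed

lemma tmul_tcom:
  assumes "f \<in> Hom C (A \<odot> B) D" "g \<in> Hom C E (A \<odot> B)" "A \<in> Obj C" "B \<in> Obj C" "Z \<in> Obj C"
  shows "tmul f A B Z \<cdot> tcom g A B Z = (f \<cdot> g) \<otimes> \<one> Z"
  using assms assms(1,2)[THEN Hom_obj] by (simp add: Hom_def tmul_def tcom_def)

lemma tcom_Comp:
  assumes "f \<in> Hom C E (A \<odot> B)" "g \<in> Hom C D E" "A \<in> Obj C" "B \<in> Obj C" "Z \<in> Obj C"
  shows "tcom (f \<cdot> g) A B Z = tcom f A B Z \<cdot> (g \<otimes> \<one> Z)"
  using assms assms(1,2)[THEN Hom_obj] by (simp add: Hom_def tcom_def)

lemma tuni_Comp:
  assumes "f \<in> Hom C A B" "g \<in> Hom C \<K> A" "Z \<in> Obj C"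
  shows "tuni (f \<cdot> g) Z = (f \<otimes> \<one> Z) \<cdot> tuni g Z"
  using assms assms(1,2)[THEN Hom_obj] by (simp add: Hom_def tuni_def)

lemma tcom_whisker_left:
  assumes "f \<in> Hom C D (A \<odot> B)" "g \<in> Hom C B E" "A \<in> Obj C" "Z \<in> Obj C"
  shows "tcom ((\<one> A \<otimes> g) \<cdot> f) A E Z = (\<one> A \<otimes> (g \<otimes> \<one> Z)) \<cdot> tcom f A B Z"
  using assms assms(1,2)[THEN Hom_obj] by (simp add: Hom_def tcom_def tail_simps)

lemma tcom_whisker_right:
  assumes "f \<in> Hom C D (A \<odot> B)" "g \<in> Hom C A E" "B \<in> Obj C" "Z \<in> Obj C"
  shows "tcom ((g \<otimes> \<one> B) \<cdot> f) E B Z = (g \<otimes> \<one> (B \<odot> Z)) \<cdot> tcom f A B Z"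
  using assms assms(1,2)[THEN Hom_obj] by (simp add: Hom_def tcom_def tail_simps)

text \<open>This lemma and the next two treat the three sides of the bimodule equations of a
  separability structure. Their source is a tensor product, hence the common remainder
  \<open>inv \<alpha>\<close>.\<close>

lemma tcom_tmul:
  assumes "f \<in> Hom C (A \<odot> B) E" "g \<in> Hom C E (P \<odot> Q)"
    "A \<in> Obj C" "B \<in> Obj C" "P \<in> Obj C" "Q \<in> Obj C" "Z \<in> Obj C"
  shows "tcom g P Q Z \<cdot> tmul f A B Z = tcom (g \<cdot> f) P Q Z \<cdot> inv (\<alpha> A B Z)"
  using assms assms(1,2)[THEN Hom_obj] by (simp add: Hom_def tcom_def tmul_def)

lemma tmul_tcom_right:
  assumes "f \<in> Hom C P (A \<odot> B)" "g \<in> Hom C (B \<odot> D) R"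
    "A \<in> Obj C" "B \<in> Obj C" "D \<in> Obj C" "Z \<in> Obj C"
  shows "(\<one> A \<otimes> tmul g B D Z) \<cdot> tcom f A B (D \<odot> Z)
    = tcom ((\<one> A \<otimes> g) \<cdot> \<alpha> A B D \<cdot> (f \<otimes> \<one> D)) A R Z \<cdot> inv (\<alpha> P D Z)"
  using assms assms(1,2)[THEN Hom_obj] by (simp add: Hom_def tcom_def tmul_def tail_simps)

lemma tmul_tcom_left:
  assumes "f \<in> Hom C P (B \<odot> D)" "g \<in> Hom C (A \<odot> B) R"
    "A \<in> Obj C" "B \<in> Obj C" "D \<in> Obj C" "Z \<in> Obj C"
  shows "tmul g A B (D \<odot> Z) \<cdot> (\<one> A \<otimes> tcom f B D Z)
    = tcom ((g \<otimes> \<one> D) \<cdot> inv (\<alpha> A B D) \<cdot> (\<one> A \<otimes> f)) R D Z \<cdot> inv (\<alpha> A P Z)"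
  using assms assms(1,2)[THEN Hom_obj] by (simp add: Hom_def tcom_def tmul_def tail_simps)

lemma tcom_inject:
  assumes "tcom f A B \<K> = tcom g A B \<K>" "f \<in> Hom C D (A \<odot> B)" "g \<in> Hom C D (A \<odot> B)"
    "A \<in> Obj C" "B \<in> Obj C"
  shows "f = g"
proof (rule whisker_right_faithful)
  show "f \<otimes> \<one> \<K> = g \<otimes> \<one> \<K>"
    by (rule iso_cancel_left[OF Assoc_iso, of A B \<K>]) (use assms in \<open>auto simp: Hom_def tcom_def\<close>)
qed (use assms in auto)

text \<open>Meant for a coproduct obtained by multiplying an element \<open>g\<close> of
  \<open>B \<odot> D\<close> from the left. The factor \<open>inv (\<ll> Z)\<close> creates the
  source \<open>\<K>\<close> of \<open>g\<close> in front of the tail.\<close>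

lemma tcom_split_right:
  assumes "f \<in> Hom C (A \<odot> B) E" "g \<in> Hom C \<K> (B \<odot> D)"
    "A \<in> Obj C" "B \<in> Obj C" "D \<in> Obj C" "Z \<in> Obj C"
  shows "tcom ((f \<otimes> \<one> D) \<cdot> inv (\<alpha> A B D) \<cdot> (\<one> A \<otimes> g) \<cdot> inv (\<rr> A)) E D Z
    = tmul f A B (D \<odot> Z) \<cdot> (\<one> A \<otimes> (tcom g B D Z \<cdot> inv (\<ll> Z)))"
  using assms assms(1,2)[THEN Hom_obj] by (simp add: Hom_def tcom_def tmul_def tail_simps)

end

section \<open>Units, tails and the braiding\<close>

context braided_monoidal_category
begin

lemma Braid_arr [simp]:
  assumes "A \<in> Obj C" "B \<in> Obj C"
  shows "\<gamma> A B \<in> Arr C" "Dom C (\<gamma> A B) = A \<odot> B" "Cod C (\<gamma> A B) = B \<odot> A"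
  using Braid_hom[OF assms] by (auto simp: Hom_def)

text \<open>Not among the axioms of a braiding. Naturality against \<open>\<ll> \<K>\<close> and the
  hexagon with two copies of \<open>\<K>\<close> produce \<open>\<gamma> A \<K>\<close> on both
  sides; cancelling it and the tensor factor \<open>\<K>\<close> leaves the claim.\<close>

lemma Lunit_Braid:
  assumes [simp]: "A \<in> Obj C"
  shows "\<ll> A \<cdot> \<gamma> A \<K> = \<rr> A"
proof -
  have "\<gamma> A \<K> \<cdot> (\<rr> A \<otimes> \<one> \<K>) = (\<gamma> A \<K> \<cdot> (\<one> A \<otimes> \<ll> \<K>)) \<cdot> \<alpha> A \<K> \<K>"
    by (simp add: triangle)
  also have "\<dots> = (\<ll> \<K> \<otimes> \<one> A) \<cdot> \<gamma> A (\<K> \<odot> \<K>) \<cdot> \<alpha> A \<K> \<K>"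
    by (subst Braid_natural[of _ A A _ "\<K> \<odot> \<K>" \<K>]) auto
  also have "\<dots> = \<ll> (\<K> \<odot> A) \<cdot> (\<alpha> \<K> \<K> A \<cdot> \<gamma> A (\<K> \<odot> \<K>) \<cdot> \<alpha> A \<K> \<K>)"
    by (simp add: Lunit_Id_right)
  also have "\<dots> = \<ll> (\<K> \<odot> A) \<cdot> ((\<one> \<K> \<otimes> \<gamma> A \<K>) \<cdot> \<alpha> \<K> A \<K> \<cdot> (\<gamma> A \<K> \<otimes> \<one> \<K>))"
    by (subst hexagon1) simp_all
  also have "\<dots> = \<gamma> A \<K> \<cdot> (\<ll> A \<cdot> \<gamma> A \<K>) \<otimes> \<one> \<K>"
    by (simp add: Comp_reassoc[OF Lunit_natural_arr] Lunit_Id_right)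
  finally have "\<rr> A \<otimes> \<one> \<K> = (\<ll> A \<cdot> \<gamma> A \<K>) \<otimes> \<one> \<K>"
    by (rule iso_cancel_left[OF Braid_iso, rotated 2]) simp_all
  then show ?thesis
    by - (rule whisker_right_faithful[symmetric], auto)
qed

text \<open>The braiding need not be a symmetry, so \<open>\<gamma> \<K> A\<close> is not assumed
  inverse to \<open>\<gamma> A \<K>\<close>; the mirrored argument runs through
  \<open>hexagon2\<close>.\<close>

lemma Runit_Braid:
  assumes [simp]: "A \<in> Obj C"
  shows "\<rr> A \<cdot> \<gamma> \<K> A = \<ll> A"
proof -
  have "(\<ll> (A \<odot> \<K>)) \<cdot> (\<one> \<K> \<otimes> \<gamma> \<K> A) = \<gamma> \<K> A \<cdot> (\<ll> \<K> \<otimes> \<one> A) \<cdot> inv (\<alpha> \<K> \<K> A)"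
    by (simp add: Lunit_natural_arr Lunit_Id_right)
  also have "\<dots> = (\<gamma> \<K> A \<cdot> (\<ll> \<K> \<otimes> \<one> A)) \<cdot> inv (\<alpha> \<K> \<K> A)"
    by simp
  also have "\<dots> = (\<one> A \<otimes> \<ll> \<K>) \<cdot> \<gamma> (\<K> \<odot> \<K>) A \<cdot> inv (\<alpha> \<K> \<K> A)"
    by (subst Braid_natural[of _ "\<K> \<odot> \<K>" \<K> _ A A]) auto
  also have "\<dots> = (\<rr> A \<otimes> \<one> \<K>) \<cdot> (inv (\<alpha> A \<K> \<K>) \<cdot> \<gamma> (\<K> \<odot> \<K>) A \<cdot> inv (\<alpha> \<K> \<K> A))"
    by (simp add: Runit_Id_right)
  also have "\<dots> = (\<rr> A \<otimes> \<one> \<K>) \<cdot> ((\<gamma> \<K> A \<otimes> \<one> \<K>) \<cdot> inv (\<alpha> \<K> A \<K>) \<cdot> (\<one> \<K> \<otimes> \<gamma> \<K> A))"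
    by (subst hexagon2) simp_all
  also have "\<dots> = ((\<rr> A \<cdot> \<gamma> \<K> A) \<otimes> \<one> \<K> \<cdot> inv (\<alpha> \<K> A \<K>)) \<cdot> (\<one> \<K> \<otimes> \<gamma> \<K> A)"
    by simp
  finally have "\<ll> (A \<odot> \<K>) = (\<rr> A \<cdot> \<gamma> \<K> A) \<otimes> \<one> \<K> \<cdot> inv (\<alpha> \<K> A \<K>)"
    by (rule iso_cancel_right[OF iso_whisker_left[OF Braid_iso], rotated 3]) simp_all
  then have "\<ll> A \<otimes> \<one> \<K> = ((\<rr> A \<cdot> \<gamma> \<K> A) \<otimes> \<one> \<K> \<cdot> inv (\<alpha> \<K> A \<K>)) \<cdot> \<alpha> \<K> A \<K>"
    by (simp only: Lunit_Id_right assms Unit_obj)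
  then have "\<ll> A \<otimes> \<one> \<K> = (\<rr> A \<cdot> \<gamma> \<K> A) \<otimes> \<one> \<K>"
    by simp
  then show ?thesis
    by - (rule whisker_right_faithful[symmetric], auto)
qed

definition tbra :: "'a \<Rightarrow> 'a \<Rightarrow> 'a \<Rightarrow> 'b"
  where "tbra A B Z = \<alpha> B A Z \<cdot> (\<gamma> A B \<otimes> \<one> Z) \<cdot> inv (\<alpha> A B Z)"

lemma tbra_arr [simp]:
  assumes "A \<in> Obj C" "B \<in> Obj C" "Z \<in> Obj C"
  shows "tbra A B Z \<in> Arr C" "Dom C (tbra A B Z) = A \<odot> (B \<odot> Z)" "Cod C (tbra A B Z) = B \<odot> (A \<odot> Z)"
  using assms by (auto simp: tbra_def)

lemma tbra_natural:
  assumes "h \<in> Arr C" "Cod C h = Z'" "Dom C h = Z" and [simp]: "A \<in> Obj C" "B \<in> Obj C"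
  shows "tbra A B Z' \<cdot> (\<one> A \<otimes> (\<one> B \<otimes> h)) = (\<one> B \<otimes> (\<one> A \<otimes> h)) \<cdot> tbra A B Z"
proof -
  \<comment> \<open>The braiding is regarded as shaped like a comultiplication with source
    \<open>A \<odot> B\<close>, so that \<open>tcom_natural\<close> covers it.\<close>
  have eq: "tbra A B W = tcom (\<gamma> A B) B A W \<cdot> inv (\<alpha> A B W)" if "W \<in> Obj C" for W
    using that by (simp add: tbra_def tcom_def)
  have obj: "Z \<in> Obj C" "Z' \<in> Obj C"
    using assms Dom_obj Cod_obj by auto
  have "inv (\<alpha> A B Z') \<cdot> (\<one> A \<otimes> (\<one> B \<otimes> h)) = (\<one> (A \<odot> B) \<otimes> h) \<cdot> inv (\<alpha> A B Z)"
    using assms obj by (simp add: tail_simps)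
  then have "tbra A B Z' \<cdot> (\<one> A \<otimes> (\<one> B \<otimes> h))
    = (tcom (\<gamma> A B) B A Z' \<cdot> (\<one> (A \<odot> B) \<otimes> h)) \<cdot> inv (\<alpha> A B Z)"
    using assms obj by (simp add: eq tcom_arr[OF Braid_hom])
  also have "\<dots> = (\<one> B \<otimes> (\<one> A \<otimes> h)) \<cdot> tbra A B Z"
    using assms obj by (simp add: eq tcom_natural[OF Braid_hom] tcom_arr[OF Braid_hom])
  finally show ?thesis .
qed

text \<open>An arrow out of \<open>\<K>\<close> crosses the braiding freely: naturality replaces
  \<open>\<gamma> A B\<close> by \<open>\<gamma> A \<K>\<close>, which \<open>Lunit_Braid\<close>
  turns into unitors. Integrals are moved across the braiding in this way.\<close>

lemma tbra_tuni_right: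
  assumes f: "f \<in> Hom C \<K> B" and [simp]: "A \<in> Obj C" "Z \<in> Obj C"
  shows "tbra A B Z \<cdot> (\<one> A \<otimes> tuni f Z) = tuni f (A \<odot> Z)"
proof -
  note [simp] = f[THEN Hom_arr] f[THEN Hom_obj]
  have \<gamma>: "\<gamma> A \<K> \<cdot> inv (\<rr> A) = inv (\<ll> A)"
    by (rule iso_cancel_left[OF Lunit_iso, of A]) (simp_all add: Comp_reassoc[OF Lunit_Braid])
  have "tbra A B Z \<cdot> (\<one> A \<otimes> tuni f Z) = \<alpha> B A Z \<cdot> ((\<gamma> A B \<cdot> (\<one> A \<otimes> f)) \<cdot> inv (\<rr> A)) \<otimes> \<one> Z"
    by (simp add: tbra_def tuni_def tail_simps)
  also have "\<dots> = \<alpha> B A Z \<cdot> ((f \<otimes> \<one> A) \<cdot> \<gamma> A \<K> \<cdot> inv (\<rr> A)) \<otimes> \<one> Z"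
    by (subst Braid_natural[of _ A A _ \<K> B]) (auto simp del: whisker_right)
  also have "\<dots> = tuni f (A \<odot> Z)"
    by (simp only: \<gamma>) (simp add: tuni_def tail_simps)
  finally show ?thesis .
qed

lemma tbra_tuni_left:
  assumes f: "f \<in> Hom C \<K> A" and [simp]: "B \<in> Obj C" "Z \<in> Obj C"
  shows "tbra A B Z \<cdot> tuni f (B \<odot> Z) = \<one> B \<otimes> tuni f Z"
proof -
  note [simp] = f[THEN Hom_arr] f[THEN Hom_obj]
  have \<gamma>: "\<gamma> \<K> B \<cdot> inv (\<ll> B) = inv (\<rr> B)"
    by (rule iso_cancel_left[OF Runit_iso, of B]) (simp_all add: Comp_reassoc[OF Runit_Braid])
  have "tbra A B Z \<cdot> tuni f (B \<odot> Z) = \<alpha> B A Z \<cdot> ((\<gamma> A B \<cdot> (f \<otimes> \<one> B)) \<cdot> inv (\<ll> B)) \<otimes> \<one> Z"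
    by (simp add: tbra_def tuni_def tail_simps)
  also have "\<dots> = \<alpha> B A Z \<cdot> ((\<one> B \<otimes> f) \<cdot> \<gamma> \<K> B \<cdot> inv (\<ll> B)) \<otimes> \<one> Z"
    by (subst Braid_natural[of _ \<K> A _ B B]) (auto simp del: whisker_right)
  also have "\<dots> = \<one> B \<otimes> tuni f Z"
    by (simp only: \<gamma>) (simp add: tuni_def tail_simps)
  finally show ?thesis .
qed

text \<open>The bialgebra axiom in strict form. Here the bracketing inside
  \<open>tensor_comult\<close> is unravelled.\<close>

lemma tcom_tmul_tensor:
  assumes f: "f \<in> Hom C (A \<odot> B) D"
    and dA: "dA \<in> Hom C A (A \<odot> A)" and dB: "dB \<in> Hom C B (B \<odot> B)" and dD: "dD \<in> Hom C D (D \<odot> D)"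
    and [simp]: "Z \<in> Obj C"
    and eq: "dD \<cdot> f = (f \<otimes> f) \<cdot> tensor_comult C A dA B dB"
  shows "tcom dD D D Z \<cdot> tmul f A B Z
    = (\<one> D \<otimes> tmul f A B Z) \<cdot> tmul f A B (A \<odot> (B \<odot> Z)) \<cdot> (\<one> A \<otimes> tbra A B (B \<odot> Z)) \<cdot>
      tcom dA A A (B \<odot> (B \<odot> Z)) \<cdot> (\<one> A \<otimes> tcom dB B B Z)"
proof -
  note [simp] = f[THEN Hom_arr] f[THEN Hom_obj] dA[THEN Hom_arr] dA[THEN Hom_obj]
    dB[THEN Hom_arr] dB[THEN Hom_obj] dD[THEN Hom_arr]
    tmul_arr[OF f] tcom_arr[OF dA] tcom_arr[OF dB] tcom_arr[OF dD]
  have [simp]: "A \<in> Obj C" "B \<in> Obj C"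
    using dA dB Hom_obj by auto
  \<comment> \<open>\<open>b\<close> braids the first two of three factors. \<open>p\<close> to
    \<open>u\<close> are the factors of \<open>f \<otimes> f\<close> after
    \<open>tensor_comult\<close>, each with tail \<open>Z\<close>; \<open>v\<close> to
    \<open>y\<close> rebracket the intermediate stages. The opaque names let each equation below
    unfold only the factors it concerns.\<close>
  define b where "b = \<alpha> B A B \<cdot> (\<gamma> A B \<otimes> \<one> B) \<cdot> inv (\<alpha> A B B)"
  define p where "p = (f \<otimes> f) \<otimes> \<one> Z"
  define q where "q = inv (\<alpha> A B (A \<odot> B)) \<otimes> \<one> Z"
  define r where "r = (\<one> A \<otimes> b) \<otimes> \<one> Z"
  define s where "s = \<alpha> A A (B \<odot> B) \<otimes> \<one> Z"
  define t where "t = (dA \<otimes> \<one> (B \<odot> B)) \<otimes> \<one> Z"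
  define u where "u = (\<one> A \<otimes> dB) \<otimes> \<one> Z"
  define v where "v = \<one> A \<otimes> ((\<one> B \<otimes> \<alpha> A B Z) \<cdot> \<alpha> B (A \<odot> B) Z)"
  define w where "w = \<one> A \<otimes> ((\<one> A \<otimes> \<alpha> B B Z) \<cdot> \<alpha> A (B \<odot> B) Z)"
  define x where "x = \<one> (A \<odot> B) \<otimes> \<alpha> A B Z"
  define y where "y = \<one> A \<otimes> \<alpha> B B Z"
  define fg where "fg = (\<one> D \<otimes> tmul f A B Z) \<cdot> tmul f A B (A \<odot> (B \<odot> Z))"
  have b [simp]: "b \<in> Arr C" "Dom C b = A \<odot> (B \<odot> B)" "Cod C b = B \<odot> (A \<odot> B)"
    by (simp_all add: b_def)
  note arr = p_def q_def r_def s_def t_def u_def v_def w_def x_def y_def fg_def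
  have [simp]: "fg \<in> Arr C" "Dom C fg = A \<odot> (B \<odot> (A \<odot> (B \<odot> Z)))" "Cod C fg = D \<odot> (D \<odot> Z)"
    "p \<in> Arr C" "Dom C p = ((A \<odot> B) \<odot> (A \<odot> B)) \<odot> Z" "Cod C p = (D \<odot> D) \<odot> Z"
    "q \<in> Arr C" "Dom C q = (A \<odot> (B \<odot> (A \<odot> B))) \<odot> Z" "Cod C q = ((A \<odot> B) \<odot> (A \<odot> B)) \<odot> Z"
    "r \<in> Arr C" "Dom C r = (A \<odot> (A \<odot> (B \<odot> B))) \<odot> Z" "Cod C r = (A \<odot> (B \<odot> (A \<odot> B))) \<odot> Z"
    "s \<in> Arr C" "Dom C s = ((A \<odot> A) \<odot> (B \<odot> B)) \<odot> Z" "Cod C s = (A \<odot> (A \<odot> (B \<odot> B))) \<odot> Z"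
    "t \<in> Arr C" "Dom C t = (A \<odot> (B \<odot> B)) \<odot> Z" "Cod C t = ((A \<odot> A) \<odot> (B \<odot> B)) \<odot> Z"
    "u \<in> Arr C" "Dom C u = (A \<odot> B) \<odot> Z" "Cod C u = (A \<odot> (B \<odot> B)) \<odot> Z"
    "v \<in> Arr C" "Dom C v = A \<odot> ((B \<odot> (A \<odot> B)) \<odot> Z)" "Cod C v = A \<odot> (B \<odot> (A \<odot> (B \<odot> Z)))"
    "w \<in> Arr C" "Dom C w = A \<odot> ((A \<odot> (B \<odot> B)) \<odot> Z)" "Cod C w = A \<odot> (A \<odot> (B \<odot> (B \<odot> Z)))"
    "x \<in> Arr C" "Dom C x = (A \<odot> B) \<odot> ((A \<odot> B) \<odot> Z)" "Cod C x = (A \<odot> B) \<odot> (A \<odot> (B \<odot> Z))"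
    "y \<in> Arr C" "Dom C y = A \<odot> ((B \<odot> B) \<odot> Z)" "Cod C y = A \<odot> (B \<odot> (B \<odot> Z))"
    by (simp_all add: arr)
  have swap: "(f \<otimes> \<one> (A \<odot> (B \<odot> Z))) \<cdot> x = (\<one> D \<otimes> \<alpha> A B Z) \<cdot> (f \<otimes> \<one> ((A \<odot> B) \<odot> Z))"
    unfolding x_def by (rule interchange) simp_all
  have ff: "f \<otimes> f = (\<one> D \<otimes> f) \<cdot> (f \<otimes> \<one> (A \<odot> B))"
    by (simp add: Tarr_Comp_arr)
  have dd: "dA \<otimes> dB = (dA \<otimes> \<one> (B \<odot> B)) \<cdot> (\<one> A \<otimes> dB)"
    by (simp add: Tarr_Comp_arr)
  have swap': "(\<one> (A \<odot> A) \<otimes> \<alpha> B B Z) \<cdot> (dA \<otimes> \<one> ((B \<odot> B) \<odot> Z)) = (dA \<otimes> \<one> (B \<odot> (B \<odot> Z))) \<cdot> y"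
    unfolding y_def by (rule interchange[symmetric]) simp_all
  \<comment> \<open>Equations \<open>1\<close> to \<open>6\<close> carry the accumulated
    rebracketing to the right past one factor after another and leave strict factors behind.\<close>
  have 1: "\<alpha> D D Z \<cdot> p = fg \<cdot> \<alpha> A B (A \<odot> (B \<odot> Z)) \<cdot> x \<cdot> \<alpha> (A \<odot> B) (A \<odot> B) Z"
    by (simp add: p_def ff fg_def tmul_def tail_simps Comp_reassoc[OF swap])
  have 2: "\<alpha> A B (A \<odot> (B \<odot> Z)) \<cdot> x \<cdot> \<alpha> (A \<odot> B) (A \<odot> B) Z \<cdot> q = v \<cdot> \<alpha> A (B \<odot> (A \<odot> B)) Z"
    by (simp add: q_def x_def v_def tail_simps)
  \<comment> \<open>The block with the braiding is compared first without the outer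
    \<open>A\<close>, which is then restored by whiskering.\<close>
  have 3: "v \<cdot> \<alpha> A (B \<odot> (A \<odot> B)) Z \<cdot> r = (\<one> A \<otimes> tbra A B (B \<odot> Z)) \<cdot> w \<cdot> \<alpha> A (A \<odot> (B \<odot> B)) Z"
  proof -
    have "((\<one> B \<otimes> \<alpha> A B Z) \<cdot> \<alpha> B (A \<odot> B) Z) \<cdot> (b \<otimes> \<one> Z)
      = tbra A B (B \<odot> Z) \<cdot> ((\<one> A \<otimes> \<alpha> B B Z) \<cdot> \<alpha> A (B \<odot> B) Z)"
      by (simp add: b_def tbra_def tail_simps)
    from whisker_left_eq[OF this, of A] have "v \<cdot> (\<one> A \<otimes> (b \<otimes> \<one> Z)) = (\<one> A \<otimes> tbra A B (B \<odot> Z)) \<cdot> w"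
      by (simp add: v_def w_def)
    from Comp_reassoc[OF this, of "\<alpha> A (A \<odot> (B \<odot> B)) Z"] show ?thesis
      by (simp add: r_def tail_simps)
  qed
  have 4: "w \<cdot> \<alpha> A (A \<odot> (B \<odot> B)) Z \<cdot> s
    = \<alpha> A A (B \<odot> (B \<odot> Z)) \<cdot> (\<one> (A \<odot> A) \<otimes> \<alpha> B B Z) \<cdot> \<alpha> (A \<odot> A) (B \<odot> B) Z"
    by (simp add: s_def w_def tail_simps)
  have 5: "(\<one> (A \<odot> A) \<otimes> \<alpha> B B Z) \<cdot> \<alpha> (A \<odot> A) (B \<odot> B) Z \<cdot> t
    = (dA \<otimes> \<one> (B \<odot> (B \<odot> Z))) \<cdot> y \<cdot> \<alpha> A (B \<odot> B) Z"
    using Comp_reassoc[OF swap', of "\<alpha> A (B \<odot> B) Z"]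
    by (simp add: t_def Tarr_Id_right_Id_right)
  have 6: "y \<cdot> \<alpha> A (B \<odot> B) Z \<cdot> u \<cdot> inv (\<alpha> A B Z) = \<one> A \<otimes> tcom dB B B Z"
    by (simp add: u_def y_def tcom_def tail_simps)
  have "tcom dD D D Z \<cdot> tmul f A B Z = \<alpha> D D Z \<cdot> ((dD \<cdot> f) \<otimes> \<one> Z) \<cdot> inv (\<alpha> A B Z)"
    by (simp add: tcom_def tmul_def)
  also have "tensor_comult C A dA B dB = inv (\<alpha> A B (A \<odot> B)) \<cdot> (\<one> A \<otimes> b) \<cdot> \<alpha> A A (B \<odot> B) \<cdot>
      (dA \<otimes> \<one> (B \<odot> B)) \<cdot> (\<one> A \<otimes> dB)"
    by (simp add: tensor_comult_def b_def dd)
  then have "\<alpha> D D Z \<cdot> ((dD \<cdot> f) \<otimes> \<one> Z) \<cdot> inv (\<alpha> A B Z)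
    = (\<alpha> D D Z \<cdot> p) \<cdot> q \<cdot> r \<cdot> s \<cdot> t \<cdot> u \<cdot> inv (\<alpha> A B Z)"
    by (simp add: eq p_def q_def r_def s_def t_def u_def)
  also have "\<dots> = fg \<cdot> (\<alpha> A B (A \<odot> (B \<odot> Z)) \<cdot> x \<cdot> \<alpha> (A \<odot> B) (A \<odot> B) Z \<cdot> q) \<cdot> r \<cdot> s \<cdot> t \<cdot> u \<cdot> inv (\<alpha> A B Z)"
    by (simp add: 1)
  also have "\<dots> = fg \<cdot> (v \<cdot> \<alpha> A (B \<odot> (A \<odot> B)) Z \<cdot> r) \<cdot> s \<cdot> t \<cdot> u \<cdot> inv (\<alpha> A B Z)"
    by (simp add: 2)
  also have "\<dots> = fg \<cdot> (\<one> A \<otimes> tbra A B (B \<odot> Z)) \<cdot> (w \<cdot> \<alpha> A (A \<odot> (B \<odot> B)) Z \<cdot> s) \<cdot> t \<cdot> u \<cdot> inv (\<alpha> A B Z)"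
    by (simp add: 3)
  also have "\<dots> = fg \<cdot> (\<one> A \<otimes> tbra A B (B \<odot> Z)) \<cdot> \<alpha> A A (B \<odot> (B \<odot> Z)) \<cdot>
      ((\<one> (A \<odot> A) \<otimes> \<alpha> B B Z) \<cdot> \<alpha> (A \<odot> A) (B \<odot> B) Z \<cdot> t) \<cdot> u \<cdot> inv (\<alpha> A B Z)"
    by (simp add: 4)
  also have "\<dots> = fg \<cdot> (\<one> A \<otimes> tbra A B (B \<odot> Z)) \<cdot> tcom dA A A (B \<odot> (B \<odot> Z)) \<cdot>
      (y \<cdot> \<alpha> A (B \<odot> B) Z \<cdot> u \<cdot> inv (\<alpha> A B Z))"
    by (simp add: 5 tcom_def)
  finally show ?thesis
    by (simp add: 6 fg_def)
qed

end

section \<open>Hopf categories\<close>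

text \<open>The antipode, existentially quantified in \<open>hopf_category\<close>, becomes a
  parameter.\<close>

locale hopf_category_with_antipode = braided_monoidal_category C
  for C :: "('o, 'm, 'z) brcat_scheme" (structure) +
  fixes X :: "'x set" and a :: "'x \<Rightarrow> 'x \<Rightarrow> 'o" and \<delta> \<epsilon> :: "'x \<Rightarrow> 'x \<Rightarrow> 'm"
    and \<mu> :: "'x \<Rightarrow> 'x \<Rightarrow> 'x \<Rightarrow> 'm" and \<eta> :: "'x \<Rightarrow> 'm" and \<sigma> :: "'x \<Rightarrow> 'x \<Rightarrow> 'm"
  assumes enriched: "comonoid_enriched_category C X a \<delta> \<epsilon> \<mu> \<eta>"
    and \<sigma>_hom: "\<lbrakk>x \<in> X; y \<in> X\<rbrakk> \<Longrightarrow> \<sigma> x y \<in> Hom C (a x y) (a y x)"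
    and antipode_right: "\<lbrakk>x \<in> X; y \<in> X\<rbrakk> \<Longrightarrow>
      \<mu> x y x \<cdot> (\<one> (a x y) \<otimes> \<sigma> x y) \<cdot> \<delta> x y = \<eta> x \<cdot> \<epsilon> x y"
    and antipode_left: "\<lbrakk>x \<in> X; y \<in> X\<rbrakk> \<Longrightarrow>
      \<mu> y x y \<cdot> (\<sigma> x y \<otimes> \<one> (a x y)) \<cdot> \<delta> x y = \<eta> y \<cdot> \<epsilon> x y"
begin

lemma a_obj [simp]: "\<lbrakk>x \<in> X; y \<in> X\<rbrakk> \<Longrightarrow> a x y \<in> Obj C"
  and \<delta>_hom: "\<lbrakk>x \<in> X; y \<in> X\<rbrakk> \<Longrightarrow> \<delta> x y \<in> Hom C (a x y) (a x y \<odot> a x y)"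
  and \<epsilon>_hom: "\<lbrakk>x \<in> X; y \<in> X\<rbrakk> \<Longrightarrow> \<epsilon> x y \<in> Hom C (a x y) \<K>"
  using enriched by (auto simp: comonoid_enriched_category_def comonoid_def)

lemma \<mu>_hom: "\<lbrakk>x \<in> X; y \<in> X; z \<in> X\<rbrakk> \<Longrightarrow> \<mu> x y z \<in> Hom C (a x y \<odot> a y z) (a x z)"
  and \<eta>_hom: "x \<in> X \<Longrightarrow> \<eta> x \<in> Hom C \<K> (a x x)"
  using enriched by (auto simp: comonoid_enriched_category_def comonoid_hom_def)

text \<open>The strict alphabet: one letter per structure morphism, with the tail as last argument.
  \<open>s\<close> needs no rebracketing, as source and target of the antipode are single
  factors.\<close>

definition m where "m x y z Z = tmul (\<mu> x y z) (a x y) (a y z) Z"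
definition d where "d x y Z = tcom (\<delta> x y) (a x y) (a x y) Z"
definition e where "e x y Z = tcou (\<epsilon> x y) Z"
definition u where "u x Z = tuni (\<eta> x) Z"
definition s where "s x y Z = \<sigma> x y \<otimes> \<one> Z"
definition g where "g x y z w Z = tbra (a x y) (a z w) Z"

abbreviation L where "L x y f \<equiv> \<one> (a x y) \<otimes> f"

lemma m_arr [simp]:
  assumes "x \<in> X" "y \<in> X" "z \<in> X" "Z \<in> Obj C"
  shows "m x y z Z \<in> Arr C" "Dom C (m x y z Z) = a x y \<odot> (a y z \<odot> Z)" "Cod C (m x y z Z) = a x z \<odot> Z"
  using assms by (simp_all add: m_def tmul_arr[OF \<mu>_hom])

lemma d_arr [simp]:
  assumes "x \<in> X" "y \<in> X" "Z \<in> Obj C"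
  shows "d x y Z \<in> Arr C" "Dom C (d x y Z) = a x y \<odot> Z" "Cod C (d x y Z) = a x y \<odot> (a x y \<odot> Z)"
  using assms by (simp_all add: d_def tcom_arr[OF \<delta>_hom])

lemma e_arr [simp]:
  assumes "x \<in> X" "y \<in> X" "Z \<in> Obj C"
  shows "e x y Z \<in> Arr C" "Dom C (e x y Z) = a x y \<odot> Z" "Cod C (e x y Z) = Z"
  using assms by (simp_all add: e_def tcou_arr[OF \<epsilon>_hom])

lemma u_arr [simp]:
  assumes "x \<in> X" "Z \<in> Obj C"
  shows "u x Z \<in> Arr C" "Dom C (u x Z) = Z" "Cod C (u x Z) = a x x \<odot> Z"
  using assms by (simp_all add: u_def tuni_arr[OF \<eta>_hom])

lemma s_arr [simp]:
  assumes "x \<in> X" "y \<in> X" "Z \<in> Obj C"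
  shows "s x y Z \<in> Arr C" "Dom C (s x y Z) = a x y \<odot> Z" "Cod C (s x y Z) = a y x \<odot> Z"
  using assms \<sigma>_hom[OF assms(1,2)] by (simp_all add: s_def Hom_def)

lemma g_arr [simp]:
  assumes "x \<in> X" "y \<in> X" "z \<in> X" "w \<in> X" "Z \<in> Obj C"
  shows "g x y z w Z \<in> Arr C" "Dom C (g x y z w Z) = a x y \<odot> (a z w \<odot> Z)"
    "Cod C (g x y z w Z) = a z w \<odot> (a x y \<odot> Z)"
  using assms by (simp_all add: g_def)

lemma m_natural:
  assumes "x \<in> X" "y \<in> X" "z \<in> X" "h \<in> Arr C" "Cod C h = Z'"
  shows "m x y z Z' \<cdot> L x y (L y z h) = L x z h \<cdot> m x y z (Dom C h)"
  using assms unfolding m_def by (intro tmul_natural[OF \<mu>_hom]) auto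

lemma d_natural:
  assumes "x \<in> X" "y \<in> X" "h \<in> Arr C" "Cod C h = Z'"
  shows "d x y Z' \<cdot> L x y h = L x y (L x y h) \<cdot> d x y (Dom C h)"
  using assms unfolding d_def by (intro tcom_natural[OF \<delta>_hom]) auto

lemma e_natural:
  assumes "x \<in> X" "y \<in> X" "h \<in> Arr C" "Cod C h = Z'"
  shows "e x y Z' \<cdot> L x y h = h \<cdot> e x y (Dom C h)"
  using assms unfolding e_def by (intro tcou_natural[OF \<epsilon>_hom]) auto

lemma u_natural:
  assumes "x \<in> X" "h \<in> Arr C" "Cod C h = Z'"
  shows "u x Z' \<cdot> h = L x x h \<cdot> u x (Dom C h)"
  using assms unfolding u_def by (intro tuni_natural[OF \<eta>_hom]) auto

lemma s_natural:
  assumes "x \<in> X" "y \<in> X" "h \<in> Arr C" "Cod C h = Z'"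
  shows "s x y Z' \<cdot> L x y h = L y x h \<cdot> s x y (Dom C h)"
  using assms \<sigma>_hom[OF assms(1,2)] unfolding s_def by (intro interchange) (auto simp: Hom_def)

lemma g_natural:
  assumes "x \<in> X" "y \<in> X" "z \<in> X" "w \<in> X" "h \<in> Arr C" "Cod C h = Z'"
  shows "g x y z w Z' \<cdot> L x y (L z w h) = L z w (L x y h) \<cdot> g x y z w (Dom C h)"
  using assms unfolding g_def by (intro tbra_natural) auto

section \<open>The axioms of a Hopf category in strict form\<close>

lemma m_assoc:
  assumes "x \<in> X" "y \<in> X" "z \<in> X" "w \<in> X" "Z \<in> Obj C"
  shows "m x z w Z \<cdot> m x y z (a z w \<odot> Z) = m x y w Z \<cdot> L x y (m y z w Z)"
  unfolding m_def
  by (rule tmul_assoc[OF \<mu>_hom \<mu>_hom \<mu>_hom \<mu>_hom])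
    (use assms enriched in \<open>auto simp: comonoid_enriched_category_def\<close>)

lemma m_u_left:
  assumes "x \<in> X" "y \<in> X" "Z \<in> Obj C"
  shows "m x x y Z \<cdot> u x (a x y \<odot> Z) = \<one> (a x y \<odot> Z)"
proof -
  have "\<mu> x x y \<cdot> (\<eta> x \<otimes> \<one> (a x y)) \<cdot> inv (\<ll> (a x y)) = \<ll> (a x y) \<cdot> inv (\<ll> (a x y))"
    using assms enriched \<mu>_hom[of x x y] \<eta>_hom[of x]
    by (subst Comp_reassoc) (auto simp: Hom_def comonoid_enriched_category_def)
  \<comment> \<open>\<open>whisker_right\<close> is switched off so that the whole composite stays
    under one \<open>\<otimes> \<one> Z\<close> and the equation above applies to it; later proofs
    do the same.\<close>
  then show ?thesis
    using assms by (simp add: m_def u_def tmul_tuni_left[OF \<mu>_hom \<eta>_hom] del: whisker_right)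
qed

lemma m_u_right:
  assumes "x \<in> X" "y \<in> X" "Z \<in> Obj C"
  shows "m x y y Z \<cdot> L x y (u y Z) = \<one> (a x y \<odot> Z)"
proof -
  have "\<mu> x y y \<cdot> (\<one> (a x y) \<otimes> \<eta> y) \<cdot> inv (\<rr> (a x y)) = \<rr> (a x y) \<cdot> inv (\<rr> (a x y))"
    using assms enriched \<mu>_hom[of x y y] \<eta>_hom[of y]
    by (subst Comp_reassoc) (auto simp: Hom_def comonoid_enriched_category_def)
  then show ?thesis
    using assms by (simp add: m_def u_def tmul_tuni_right[OF \<mu>_hom \<eta>_hom] del: whisker_right)
qed

lemma d_coassoc:
  assumes "x \<in> X" "y \<in> X" "Z \<in> Obj C"
  shows "L x y (d x y Z) \<cdot> d x y Z = d x y (a x y \<odot> Z) \<cdot> d x y Z"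
  unfolding d_def
  by (rule tcom_coassoc[OF \<delta>_hom, symmetric])
    (use assms enriched in \<open>auto simp: comonoid_enriched_category_def comonoid_def\<close>)

lemma e_d_left:
  assumes "x \<in> X" "y \<in> X" "Z \<in> Obj C"
  shows "e x y (a x y \<odot> Z) \<cdot> d x y Z = \<one> (a x y \<odot> Z)"
  unfolding d_def e_def using assms enriched
  by (subst tcou_tcom_left[OF \<delta>_hom \<epsilon>_hom])
    (auto simp: comonoid_enriched_category_def comonoid_def simp del: whisker_right)

lemma e_d_right:
  assumes "x \<in> X" "y \<in> X" "Z \<in> Obj C"
  shows "L x y (e x y Z) \<cdot> d x y Z = \<one> (a x y \<odot> Z)"
  unfolding d_def e_def using assms enriched
  by (subst tcou_tcom_right[OF \<delta>_hom \<epsilon>_hom])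
    (auto simp: comonoid_enriched_category_def comonoid_def simp del: whisker_right)

lemma e_m:
  assumes "x \<in> X" "y \<in> X" "z \<in> X" "Z \<in> Obj C"
  shows "e x z Z \<cdot> m x y z Z = e y z Z \<cdot> e x y (a y z \<odot> Z)"
  unfolding m_def e_def
  by (rule tcou_tmul[OF \<mu>_hom \<epsilon>_hom \<epsilon>_hom \<epsilon>_hom])
    (use assms enriched in \<open>auto simp: comonoid_enriched_category_def comonoid_hom_def tensor_counit_def\<close>)

lemma e_u:
  assumes "x \<in> X" "Z \<in> Obj C"
  shows "e x x Z \<cdot> u x Z = \<one> Z"
  unfolding u_def e_def
  by (rule tcou_tuni[OF \<epsilon>_hom \<eta>_hom])
    (use assms enriched in \<open>auto simp: comonoid_enriched_category_def comonoid_hom_def unit_counit_def\<close>)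

text \<open>The one axiom involving the braiding. In Sweedler notation (p q)1 \<otimes> (p q)2 = p1
  q1 \<otimes> p2 q2; read from the right: split q, split p, cross p2 with q1, multiply the first
  pair, then the second.\<close>

lemma d_m:
  assumes "x \<in> X" "y \<in> X" "z \<in> X" "Z \<in> Obj C"
  shows "d x z Z \<cdot> m x y z Z = L x z (m x y z Z) \<cdot> m x y z (a x y \<odot> (a y z \<odot> Z)) \<cdot>
    L x y (g x y y z (a y z \<odot> Z)) \<cdot> d x y (a y z \<odot> (a y z \<odot> Z)) \<cdot> L x y (d y z Z)"
  unfolding m_def d_def g_def
  by (rule tcom_tmul_tensor[OF \<mu>_hom \<delta>_hom \<delta>_hom \<delta>_hom])
    (use assms enriched in \<open>auto simp: comonoid_enriched_category_def comonoid_hom_def\<close>)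

text \<open>The comultiplication followed by \<open>\<sigma>\<close> on the second leg is again
  shaped like a comultiplication, so \<open>tmul_tcom\<close> applies and its associators
  cancel.\<close>

lemma m_s_d_right:
  assumes "x \<in> X" "y \<in> X" "Z \<in> Obj C"
  shows "m x y x Z \<cdot> L x y (s x y Z) \<cdot> d x y Z = u x Z \<cdot> e x y Z"
proof -
  have "L x y (\<sigma> x y) \<cdot> \<delta> x y \<in> Hom C (a x y) (a x y \<odot> a y x)"
    using assms \<delta>_hom[of x y] \<sigma>_hom[of x y] by (auto simp: Hom_def)
  note eq = tmul_tcom[OF \<mu>_hom this, of Z] and hs = tcom_whisker_left[OF \<delta>_hom \<sigma>_hom, of x y Z]
  show ?thesis
    using assms eq
    by (simp add: m_def d_def s_def e_def u_def tuni_tcou[OF \<epsilon>_hom \<eta>_hom] hs antipode_right del: whisker_right)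
qed

lemma m_s_d_left:
  assumes "x \<in> X" "y \<in> X" "Z \<in> Obj C"
  shows "m y x y Z \<cdot> s x y (a x y \<odot> Z) \<cdot> d x y Z = u y Z \<cdot> e x y Z"
proof -
  have "(\<sigma> x y \<otimes> \<one> (a x y)) \<cdot> \<delta> x y \<in> Hom C (a x y) (a y x \<odot> a x y)"
    using assms \<delta>_hom[of x y] \<sigma>_hom[of x y] by (auto simp: Hom_def)
  note eq = tmul_tcom[OF \<mu>_hom this, of Z] and hs = tcom_whisker_right[OF \<delta>_hom \<sigma>_hom, of x y Z]
  show ?thesis
    using assms eq
    by (simp add: m_def d_def s_def e_def u_def tuni_tcou[OF \<epsilon>_hom \<eta>_hom] hs antipode_left del: whisker_right)
qed

section \<open>Integral families in strict form\<close>

definition t where "t \<theta> x y Z = tuni (\<theta> x y) Z"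

abbreviation hom_family where
  "hom_family \<theta> \<equiv> \<forall>x\<in>X. \<forall>y\<in>X. \<theta> x y \<in> Hom C \<K> (a x y)"

lemma t_arr [simp]:
  assumes "hom_family \<theta>" "x \<in> X" "y \<in> X" "Z \<in> Obj C"
  shows "t \<theta> x y Z \<in> Arr C" "Dom C (t \<theta> x y Z) = Z" "Cod C (t \<theta> x y Z) = a x y \<odot> Z"
  using assms tuni_arr[of "\<theta> x y" "a x y" Z] by (simp_all add: t_def)

lemma t_natural:
  assumes "hom_family \<theta>" "x \<in> X" "y \<in> X" "h \<in> Arr C" "Cod C h = Z'"
  shows "t \<theta> x y Z' \<cdot> h = L x y h \<cdot> t \<theta> x y (Dom C h)"
  using assms unfolding t_def by (intro tuni_natural) auto

lemma g_t_right:
  assumes "hom_family \<theta>" "x \<in> X" "y \<in> X" "z \<in> X" "w \<in> X" "Z \<in> Obj C"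
  shows "g x y z w Z \<cdot> L x y (t \<theta> z w Z) = t \<theta> z w (a x y \<odot> Z)"
  using assms unfolding g_def t_def by (intro tbra_tuni_right) auto

lemma g_t_left:
  assumes "hom_family \<theta>" "x \<in> X" "y \<in> X" "z \<in> X" "w \<in> X" "Z \<in> Obj C"
  shows "g x y z w Z \<cdot> t \<theta> x y (a z w \<odot> Z) = L z w (t \<theta> x y Z)"
  using assms unfolding g_def t_def by (intro tbra_tuni_left) auto

lemma integral_normalized_iff:
  assumes "hom_family \<theta>" "x \<in> X" "y \<in> X"
  shows "\<epsilon> x y \<cdot> \<theta> x y = \<one> \<K> \<longleftrightarrow> (\<forall>Z\<in>Obj C. e x y Z \<cdot> t \<theta> x y Z = \<one> Z)"
proof
  assume "\<epsilon> x y \<cdot> \<theta> x y = \<one> \<K>"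
  then show "\<forall>Z\<in>Obj C. e x y Z \<cdot> t \<theta> x y Z = \<one> Z"
    unfolding e_def t_def using assms by (intro ballI tcou_tuni[OF \<epsilon>_hom]) auto
next
  assume R: "\<forall>Z\<in>Obj C. e x y Z \<cdot> t \<theta> x y Z = \<one> Z"
  have [simp]: "\<theta> x y \<in> Arr C" "Dom C (\<theta> x y) = \<K>" "Cod C (\<theta> x y) = a x y"
    "\<epsilon> x y \<in> Arr C" "Dom C (\<epsilon> x y) = a x y" "Cod C (\<epsilon> x y) = \<K>"
    using assms \<epsilon>_hom[of x y] by (auto simp: Hom_def)
  \<comment> \<open>The tail \<open>\<K>\<close> is enough: conjugation with
    \<open>\<ll> \<K>\<close> turns the strict equation back into a whiskered one.\<close>
  have "((\<epsilon> x y \<cdot> \<theta> x y) \<otimes> \<one> \<K>) = inv (\<ll> \<K>) \<cdot> (e x y \<K> \<cdot> t \<theta> x y \<K>) \<cdot> \<ll> \<K>"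
    using assms by (simp add: e_def t_def tcou_def tuni_def)
  also have "\<dots> = \<one> \<K> \<otimes> \<one> \<K>"
    by (subst R[rule_format]) simp_all
  finally show "\<epsilon> x y \<cdot> \<theta> x y = \<one> \<K>"
    by (rule whisker_right_faithful) auto
qed

lemma Id_right_faithful:
  assumes "f \<in> Hom C A B" "h \<in> Hom C A B"
  shows "f = h \<longleftrightarrow> (\<forall>Z\<in>Obj C. f \<otimes> \<one> Z = h \<otimes> \<one> Z)"
  using assms whisker_right_faithful[of f h A B] by auto

lemma left_integral_iff:
  assumes "hom_family \<theta>" "x \<in> X" "y \<in> X" "z \<in> X"
  shows "\<mu> x y z \<cdot> (\<one> (a x y) \<otimes> \<theta> y z) \<cdot> inv (\<rr> (a x y)) = \<theta> x z \<cdot> \<epsilon> x y \<longleftrightarrow>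
    (\<forall>Z\<in>Obj C. m x y z Z \<cdot> L x y (t \<theta> y z Z) = t \<theta> x z Z \<cdot> e x y Z)"
proof -
  have h: "\<theta> x z \<in> Hom C \<K> (a x z)" "\<theta> y z \<in> Hom C \<K> (a y z)"
    using assms by auto
  have "\<mu> x y z \<cdot> (\<one> (a x y) \<otimes> \<theta> y z) \<cdot> inv (\<rr> (a x y)) \<in> Hom C (a x y) (a x z)"
    "\<theta> x z \<cdot> \<epsilon> x y \<in> Hom C (a x y) (a x z)"
    using assms h \<mu>_hom[of x y z] \<epsilon>_hom[of x y] by (auto simp: Hom_def)
  then show ?thesis
    using assms
    by (simp add: m_def t_def e_def tmul_tuni_right[OF \<mu>_hom h(2)] tuni_tcou[OF \<epsilon>_hom h(1)]
        Id_right_faithful del: whisker_right)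
qed

lemma right_integral_iff:
  assumes "hom_family \<theta>" "x \<in> X" "y \<in> X" "z \<in> X"
  shows "\<mu> x y z \<cdot> (\<theta> x y \<otimes> \<one> (a y z)) \<cdot> inv (\<ll> (a y z)) = \<theta> x z \<cdot> \<epsilon> y z \<longleftrightarrow>
    (\<forall>Z\<in>Obj C. m x y z Z \<cdot> t \<theta> x y (a y z \<odot> Z) = t \<theta> x z Z \<cdot> e y z Z)"
proof -
  have h: "\<theta> x z \<in> Hom C \<K> (a x z)" "\<theta> x y \<in> Hom C \<K> (a x y)"
    using assms by auto
  have "\<mu> x y z \<cdot> (\<theta> x y \<otimes> \<one> (a y z)) \<cdot> inv (\<ll> (a y z)) \<in> Hom C (a y z) (a x z)"
    "\<theta> x z \<cdot> \<epsilon> y z \<in> Hom C (a y z) (a x z)"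
    using assms h \<mu>_hom[of x y z] \<epsilon>_hom[of y z] by (auto simp: Hom_def)
  then show ?thesis
    using assms
    by (simp add: m_def t_def e_def tmul_tuni_left[OF \<mu>_hom h(2)] tuni_tcou[OF \<epsilon>_hom h(1)]
        Id_right_faithful del: whisker_right)
qed

lemma normalized_left_integral_family_iff:
  assumes "hom_family \<theta>"
  shows "normalized_left_integral_family C X a \<epsilon> \<mu> \<theta> \<longleftrightarrow>
    (\<forall>x\<in>X. \<forall>y\<in>X. \<forall>z\<in>X. \<forall>Z\<in>Obj C. m x y z Z \<cdot> L x y (t \<theta> y z Z) = t \<theta> x z Z \<cdot> e x y Z) \<and>
    (\<forall>x\<in>X. \<forall>y\<in>X. \<forall>Z\<in>Obj C. e x y Z \<cdot> t \<theta> x y Z = \<one> Z)"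
  unfolding normalized_left_integral_family_def using assms
  by (simp add: left_integral_iff integral_normalized_iff cong: ball_cong)

lemma normalized_right_integral_family_iff:
  assumes "hom_family \<theta>"
  shows "normalized_right_integral_family C X a \<epsilon> \<mu> \<theta> \<longleftrightarrow>
    (\<forall>x\<in>X. \<forall>y\<in>X. \<forall>z\<in>X. \<forall>Z\<in>Obj C. m x y z Z \<cdot> t \<theta> x y (a y z \<odot> Z) = t \<theta> x z Z \<cdot> e y z Z) \<and>
    (\<forall>x\<in>X. \<forall>y\<in>X. \<forall>Z\<in>Obj C. e x y Z \<cdot> t \<theta> x y Z = \<one> Z)"
  unfolding normalized_right_integral_family_def using assms
  by (simp add: right_integral_iff integral_normalized_iff cong: ball_cong)

section \<open>Separability structures in strict form\<close>

definition S where "S \<Delta> x y z Z = tcom (\<Delta> x y z) (a x y) (a y z) Z"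

abbreviation comult_family where
  "comult_family \<Delta> \<equiv> \<forall>x\<in>X. \<forall>y\<in>X. \<forall>z\<in>X. \<Delta> x y z \<in> Hom C (a x z) (a x y \<odot> a y z)"

lemma S_arr [simp]:
  assumes "comult_family \<Delta>" "x \<in> X" "y \<in> X" "z \<in> X" "Z \<in> Obj C"
  shows "S \<Delta> x y z Z \<in> Arr C" "Dom C (S \<Delta> x y z Z) = a x z \<odot> Z"
    "Cod C (S \<Delta> x y z Z) = a x y \<odot> (a y z \<odot> Z)"
  using assms tcom_arr[of "\<Delta> x y z" "a x z" "a x y" "a y z" Z] by (simp_all add: S_def)

lemma S_natural:
  assumes "comult_family \<Delta>" "x \<in> X" "y \<in> X" "z \<in> X" "h \<in> Arr C" "Cod C h = Z'"
  shows "S \<Delta> x y z Z' \<cdot> L x z h = L x y (L y z h) \<cdot> S \<Delta> x y z (Dom C h)"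
  using assms unfolding S_def by (intro tcom_natural) auto

text \<open>The bimodule equations start at a tensor product, so their strict forms carry
  \<open>inv (\<alpha> P Q Z)\<close>. It is invertible, and comparison at the tail
  \<open>\<K>\<close> decides equality.\<close>

lemma tcom_inv_Assoc_iff:
  assumes "f \<in> Hom C (P \<odot> Q) (A \<odot> B)" "h \<in> Hom C (P \<odot> Q) (A \<odot> B)"
    "A \<in> Obj C" "B \<in> Obj C" "P \<in> Obj C" "Q \<in> Obj C"
  shows "f = h \<longleftrightarrow> (\<forall>Z\<in>Obj C. tcom f A B Z \<cdot> inv (\<alpha> P Q Z) = tcom h A B Z \<cdot> inv (\<alpha> P Q Z))"
proof
  assume *: "\<forall>Z\<in>Obj C. tcom f A B Z \<cdot> inv (\<alpha> P Q Z) = tcom h A B Z \<cdot> inv (\<alpha> P Q Z)"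
  have "tcom f A B \<K> = tcom h A B \<K>"
    by (rule iso_cancel_right[OF iso_inv[OF Assoc_iso], of P Q \<K>])
      (use assms * in \<open>simp_all add: tcom_arr[OF assms(1)] tcom_arr[OF assms(2)]\<close>)
  then show "f = h"
    by (rule tcom_inject) (use assms in auto)
qed simp

lemma separability_structure_iff:
  assumes h: "comult_family \<Delta>"
  shows "separability_structure C X a \<mu> \<Delta> \<longleftrightarrow>
    (\<forall>x\<in>X. \<forall>y\<in>X. \<forall>v\<in>X. \<forall>z\<in>X. \<forall>Z\<in>Obj C.
      L x v (m v y z Z) \<cdot> S \<Delta> x v y (a y z \<odot> Z) = S \<Delta> x v z Z \<cdot> m x y z Z \<and>
      S \<Delta> x v z Z \<cdot> m x y z Z = m x y v (a v z \<odot> Z) \<cdot> L x y (S \<Delta> y v z Z) \<and>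
      m x v y Z \<cdot> S \<Delta> x v y Z = \<one> (a x y \<odot> Z))"
proof -
  \<comment> \<open>Each of the three equations gets its own quantifier over tails;
    \<open>ball_conj_distrib\<close> later matches this with the single quantifier in the
    goal.\<close>
  have "(L x v (\<mu> v y z) \<cdot> \<alpha> (a x v) (a v y) (a y z) \<cdot> (\<Delta> x v y \<otimes> \<one> (a y z)) = \<Delta> x v z \<cdot> \<mu> x y z \<longleftrightarrow>
      (\<forall>Z\<in>Obj C. L x v (m v y z Z) \<cdot> S \<Delta> x v y (a y z \<odot> Z) = S \<Delta> x v z Z \<cdot> m x y z Z)) \<and>
    (\<Delta> x v z \<cdot> \<mu> x y z = (\<mu> x y v \<otimes> \<one> (a v z)) \<cdot> inv (\<alpha> (a x y) (a y v) (a v z)) \<cdot> L x y (\<Delta> y v z) \<longleftrightarrow>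
      (\<forall>Z\<in>Obj C. S \<Delta> x v z Z \<cdot> m x y z Z = m x y v (a v z \<odot> Z) \<cdot> L x y (S \<Delta> y v z Z))) \<and>
    (\<mu> x v y \<cdot> \<Delta> x v y = \<one> (a x y) \<longleftrightarrow> (\<forall>Z\<in>Obj C. m x v y Z \<cdot> S \<Delta> x v y Z = \<one> (a x y \<odot> Z)))"
    if X: "x \<in> X" "y \<in> X" "v \<in> X" "z \<in> X" for x y v z
  proof -
    have D: "\<Delta> x v y \<in> Hom C (a x y) (a x v \<odot> a v y)" "\<Delta> x v z \<in> Hom C (a x z) (a x v \<odot> a v z)"
      "\<Delta> y v z \<in> Hom C (a y z) (a y v \<odot> a v z)"
      using h X by auto
    note M = \<mu>_hom[OF X(3,2,4)] \<mu>_hom[OF X(1,2,4)] \<mu>_hom[OF X(1,2,3)] \<mu>_hom[OF X(1,3,2)]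
    have 1: "L x v (\<mu> v y z) \<cdot> \<alpha> (a x v) (a v y) (a y z) \<cdot> (\<Delta> x v y \<otimes> \<one> (a y z))
        \<in> Hom C (a x y \<odot> a y z) (a x v \<odot> a v z)"
      "\<Delta> x v z \<cdot> \<mu> x y z \<in> Hom C (a x y \<odot> a y z) (a x v \<odot> a v z)"
      "(\<mu> x y v \<otimes> \<one> (a v z)) \<cdot> inv (\<alpha> (a x y) (a y v) (a v z)) \<cdot> L x y (\<Delta> y v z)
        \<in> Hom C (a x y \<odot> a y z) (a x v \<odot> a v z)"
      "\<mu> x v y \<cdot> \<Delta> x v y \<in> Hom C (a x y) (a x y)" "\<one> (a x y) \<in> Hom C (a x y) (a x y)"
      using D M X by (auto simp: Hom_def)
    show ?thesis
      using X
      by (simp add: tcom_inv_Assoc_iff[OF 1(1,2)] tcom_inv_Assoc_iff[OF 1(2,3)] Id_right_faithful[OF 1(4,5)]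
          S_def m_def tmul_tcom_right[OF D(1) M(1)] tcom_tmul[OF M(2) D(2)] tmul_tcom_left[OF D(3) M(3)]
          tmul_tcom[OF M(4) D(1)] del: whisker_right)
  qed
  note eqs = this
  show ?thesis
    unfolding separability_structure_def using h
    by (simp add: eqs ball_conj_distrib cong: ball_cong)
qed

section \<open>Passage between separability structures and integral families\<close>

subsection \<open>Integrals and separability\<close>

text \<open>A left factor passes through \<open>\<Delta>\<close> by one bimodule law, comes out on
  the right by the other, and is absorbed there by the counit. For normalization, the counits of
  both legs give the counit of their product, and the legs multiply to the unit.\<close>

lemma separability_imp_left_integral:
  assumes sep: "separability_structure C X a \<mu> \<Delta>"
  shows "normalized_left_integral_family C X a \<epsilon> \<mu>
    (\<lambda>x y. (\<rr> (a x y) \<cdot> (\<one> (a x y) \<otimes> \<epsilon> y x) \<cdot> \<Delta> x y x) \<cdot> \<eta> x)"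
    (is "normalized_left_integral_family C X a \<epsilon> \<mu> ?\<theta>")
proof -
  have h: "comult_family \<Delta>"
    using sep by (simp add: separability_structure_def)
  note sep' = sep[unfolded separability_structure_iff[OF h], rule_format]
  have f: "\<rr> (a x y) \<cdot> (\<one> (a x y) \<otimes> \<epsilon> y x) \<cdot> \<Delta> x y x \<in> Hom C (a x x) (a x y)"
    if "x \<in> X" "y \<in> X" for x y
    using that h[rule_format, of x y x] \<epsilon>_hom[of y x] by (auto simp: Hom_def)
  have \<theta>: "hom_family ?\<theta>"
    using f \<eta>_hom Comp_hom by blast
  have t: "t ?\<theta> x y Z = L x y (e y x Z) \<cdot> S \<Delta> x y x Z \<cdot> u x Z"
    if "x \<in> X" "y \<in> X" "Z \<in> Obj C" for x y Z
    using that h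
    by (simp add: t_def e_def u_def S_def tuni_Comp[OF f \<eta>_hom] tcou_tcom_right[OF h[rule_format] \<epsilon>_hom, symmetric]
      tcou_arr[OF \<epsilon>_hom] tcom_arr[OF h[rule_format]] tuni_arr[OF \<eta>_hom]
      del: whisker_right)
  have "m x y z Z \<cdot> L x y (t ?\<theta> y z Z) = t ?\<theta> x z Z \<cdot> e x y Z"
    if [simp]: "x \<in> X" "y \<in> X" "z \<in> X" "Z \<in> Obj C" for x y z Z
  proof -
    have "m x y z Z \<cdot> L x y (t ?\<theta> y z Z)
      = (m x y z Z \<cdot> L x y (L y z (e z y Z))) \<cdot> L x y (S \<Delta> y z y Z) \<cdot> L x y (u y Z)"
      using h by (simp add: t)
    also have "\<dots> = L x z (e z y Z) \<cdot> (m x y z (a z y \<odot> Z) \<cdot> L x y (S \<Delta> y z y Z)) \<cdot> L x y (u y Z)"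
      using h by (simp add: m_natural)
    also have "\<dots> = L x z (e z y Z) \<cdot> S \<Delta> x z y Z \<cdot> (m x y y Z \<cdot> L x y (u y Z))"
      using h by (simp add: sep'[of x y z y Z, THEN conjunct2, THEN conjunct1, symmetric])
    \<comment> \<open>Both products with a unit are the identity. Trading the right unit for the
      left one lets the other bimodule law act, which leaves \<open>S\<close> applied to a
      unit.\<close>
    also have "\<dots> = L x z (e z y Z) \<cdot> S \<Delta> x z y Z \<cdot> (m x x y Z \<cdot> u x (a x y \<odot> Z))"
      by (simp add: m_u_right m_u_left)
    also have "\<dots> = L x z (e z y Z) \<cdot> (S \<Delta> x z y Z \<cdot> m x x y Z) \<cdot> u x (a x y \<odot> Z)"
      using h by simp
    also have "\<dots> = L x z (e z y Z \<cdot> m z x y Z) \<cdot> S \<Delta> x z x (a x y \<odot> Z) \<cdot> u x (a x y \<odot> Z)"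
      using h by (simp add: sep'[of x x z y Z, THEN conjunct1, symmetric])
    \<comment> \<open>Multiplicativity of the counit splits off \<open>e x y\<close>, which acts on
      the tail only and so slides past \<open>S\<close> and \<open>u x\<close>.\<close>
    also have "e z y Z \<cdot> m z x y Z = e z x Z \<cdot> L z x (e x y Z)"
      by (simp add: e_m e_natural)
    also have "L x z (e z x Z \<cdot> L z x (e x y Z)) \<cdot> S \<Delta> x z x (a x y \<odot> Z) \<cdot> u x (a x y \<odot> Z)
      = t ?\<theta> x z Z \<cdot> e x y Z"
      using h by (simp add: t u_natural Comp_reassoc[OF S_natural])
    finally show ?thesis .
  qed
  moreover have "e x y Z \<cdot> t ?\<theta> x y Z = \<one> Z" if [simp]: "x \<in> X" "y \<in> X" "Z \<in> Obj C" for x y Z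
  proof -
    have "e x y Z \<cdot> t ?\<theta> x y Z = (e x y Z \<cdot> L x y (e y x Z)) \<cdot> S \<Delta> x y x Z \<cdot> u x Z"
      using h by (simp add: t)
    also have "\<dots> = (e x x Z \<cdot> m x y x Z) \<cdot> S \<Delta> x y x Z \<cdot> u x Z"
      by (simp add: e_m e_natural)
    also have "\<dots> = e x x Z \<cdot> (m x y x Z \<cdot> S \<Delta> x y x Z) \<cdot> u x Z"
      using h by simp
    also have "\<dots> = \<one> Z"
      by (simp add: sep'[of x x y x Z] e_u)
    finally show ?thesis .
  qed
  ultimately show ?thesis
    unfolding normalized_left_integral_family_iff[OF \<theta>] by blast
qed

text \<open>Mirror image: the counit hits the first leg, hence \<open>\<Delta> y x y\<close> and
  \<open>\<eta> y\<close>; a right factor is carried to the left and absorbed there.\<close>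

lemma separability_imp_right_integral:
  assumes sep: "separability_structure C X a \<mu> \<Delta>"
  shows "normalized_right_integral_family C X a \<epsilon> \<mu>
    (\<lambda>x y. (\<ll> (a x y) \<cdot> (\<epsilon> y x \<otimes> \<one> (a x y)) \<cdot> \<Delta> y x y) \<cdot> \<eta> y)"
    (is "normalized_right_integral_family C X a \<epsilon> \<mu> ?\<theta>")
proof -
  have h: "comult_family \<Delta>"
    using sep by (simp add: separability_structure_def)
  note sep' = sep[unfolded separability_structure_iff[OF h], rule_format]
  have f: "\<ll> (a x y) \<cdot> (\<epsilon> y x \<otimes> \<one> (a x y)) \<cdot> \<Delta> y x y \<in> Hom C (a y y) (a x y)"
    if "x \<in> X" "y \<in> X" for x y
    using that h[rule_format, of y x y] \<epsilon>_hom[of y x] by (auto simp: Hom_def)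
  have \<theta>: "hom_family ?\<theta>"
    using f \<eta>_hom Comp_hom by blast
  have t: "t ?\<theta> x y Z = e y x (a x y \<odot> Z) \<cdot> S \<Delta> y x y Z \<cdot> u y Z"
    if "x \<in> X" "y \<in> X" "Z \<in> Obj C" for x y Z
    using that h
    by (simp add: t_def e_def u_def S_def tuni_Comp[OF f \<eta>_hom] tcou_tcom_left[OF h[rule_format] \<epsilon>_hom, symmetric]
      tcou_arr[OF \<epsilon>_hom] tcom_arr[OF h[rule_format]] tuni_arr[OF \<eta>_hom]
      del: whisker_right)
  have "m x y z Z \<cdot> t ?\<theta> x y (a y z \<odot> Z) = t ?\<theta> x z Z \<cdot> e y z Z"
    if [simp]: "x \<in> X" "y \<in> X" "z \<in> X" "Z \<in> Obj C" for x y z Z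
  proof -
    have "m x y z Z \<cdot> t ?\<theta> x y (a y z \<odot> Z)
      = (m x y z Z \<cdot> e y x (a x y \<odot> (a y z \<odot> Z))) \<cdot> S \<Delta> y x y (a y z \<odot> Z) \<cdot> u y (a y z \<odot> Z)"
      using h by (simp add: t)
    also have "\<dots> = e y x (a x z \<odot> Z) \<cdot> (L y x (m x y z Z) \<cdot> S \<Delta> y x y (a y z \<odot> Z)) \<cdot> u y (a y z \<odot> Z)"
      using h by (simp add: Comp_reassoc[OF e_natural])
    also have "\<dots> = e y x (a x z \<odot> Z) \<cdot> S \<Delta> y x z Z \<cdot> (m y y z Z \<cdot> u y (a y z \<odot> Z))"
      using h by (simp add: sep'[of y y x z Z, THEN conjunct1])
    also have "\<dots> = e y x (a x z \<odot> Z) \<cdot> S \<Delta> y x z Z \<cdot> (m y z z Z \<cdot> L y z (u z Z))"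
      by (simp add: m_u_right m_u_left)
    also have "\<dots> = e y x (a x z \<odot> Z) \<cdot> (S \<Delta> y x z Z \<cdot> m y z z Z) \<cdot> L y z (u z Z)"
      using h by simp
    also have "\<dots> = (e y x (a x z \<odot> Z) \<cdot> m y z x (a x z \<odot> Z)) \<cdot> L y z (S \<Delta> z x z Z) \<cdot> L y z (u z Z)"
      using h by (simp add: sep'[of y z x z Z, THEN conjunct2, THEN conjunct1])
    also have "e y x (a x z \<odot> Z) \<cdot> m y z x (a x z \<odot> Z) = e y z (a x z \<odot> Z) \<cdot> L y z (e z x (a x z \<odot> Z))"
      by (simp add: e_m e_natural)
    also have "(e y z (a x z \<odot> Z) \<cdot> L y z (e z x (a x z \<odot> Z))) \<cdot> L y z (S \<Delta> z x z Z) \<cdot> L y z (u z Z)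
      = e y z (a x z \<odot> Z) \<cdot> L y z (t ?\<theta> x z Z)"
      using h by (simp add: t)
    also have "\<dots> = t ?\<theta> x z Z \<cdot> e y z Z"
      using e_natural[of y z "t ?\<theta> x z Z" "a x z \<odot> Z"] \<theta> by simp
    finally show ?thesis .
  qed
  moreover have "e x y Z \<cdot> t ?\<theta> x y Z = \<one> Z" if [simp]: "x \<in> X" "y \<in> X" "Z \<in> Obj C" for x y Z
  proof -
    have "e x y Z \<cdot> t ?\<theta> x y Z = (e x y Z \<cdot> e y x (a x y \<odot> Z)) \<cdot> S \<Delta> y x y Z \<cdot> u y Z"
      using h by (simp add: t)
    also have "\<dots> = (e y y Z \<cdot> m y x y Z) \<cdot> S \<Delta> y x y Z \<cdot> u y Z"
      by (simp add: e_m)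
    also have "\<dots> = e y y Z \<cdot> (m y x y Z \<cdot> S \<Delta> y x y Z) \<cdot> u y Z"
      using h by simp
    also have "\<dots> = \<one> Z"
      by (simp add: sep'[of y y x y Z] e_u)
    finally show ?thesis .
  qed
  ultimately show ?thesis
    unfolding normalized_right_integral_family_iff[OF \<theta>] by blast
qed

text \<open>\<open>E\<close> is a family of Casimir elements: by \<open>comm\<close> a factor may
  move from the left of the first leg to the right of the second. The separate \<open>F\<close>
  allows the tailed form to be given in the factorization that suits the computation.\<close>

lemma separability_structure_of_Casimir:
  fixes E :: "'x \<Rightarrow> 'x \<Rightarrow> 'm"
  assumes E: "\<And>y v. \<lbrakk>y \<in> X; v \<in> X\<rbrakk> \<Longrightarrow> E y v \<in> Hom C \<K> (a y v \<odot> a v y)"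
    and F: "\<And>y v Z. \<lbrakk>y \<in> X; v \<in> X; Z \<in> Obj C\<rbrakk> \<Longrightarrow> F y v Z = tcom (E y v) (a y v) (a v y) Z \<cdot> inv (\<ll> Z)"
    and comm: "\<And>x y v Z. \<lbrakk>x \<in> X; y \<in> X; v \<in> X; Z \<in> Obj C\<rbrakk> \<Longrightarrow>
      m x y v (a v y \<odot> Z) \<cdot> L x y (F y v Z) = L x v (m v x y Z) \<cdot> F x v (a x y \<odot> Z)"
    and norm: "\<And>y v Z. \<lbrakk>y \<in> X; v \<in> X; Z \<in> Obj C\<rbrakk> \<Longrightarrow> m y v y Z \<cdot> F y v Z = u y Z"
  shows "\<exists>\<Delta>. separability_structure C X a \<mu> \<Delta>"
proof -
  define \<Delta> where "\<Delta> x v y = (\<mu> x y v \<otimes> \<one> (a v y)) \<cdot> inv (\<alpha> (a x y) (a y v) (a v y)) \<cdot>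
    (\<one> (a x y) \<otimes> E y v) \<cdot> inv (\<rr> (a x y))" for x v y
  have F_arr [simp]: "F y v Z \<in> Arr C" "Dom C (F y v Z) = Z" "Cod C (F y v Z) = a y v \<odot> (a v y \<odot> Z)"
    if "y \<in> X" "v \<in> X" "Z \<in> Obj C" for y v Z
    using that by (simp_all add: F tcom_arr[OF E])
  have h: "comult_family \<Delta>"
    unfolding \<Delta>_def using \<mu>_hom E by (auto simp: Hom_def)
  have S1: "S \<Delta> x v y Z = m x y v (a v y \<odot> Z) \<cdot> L x y (F y v Z)"
    if "x \<in> X" "y \<in> X" "v \<in> X" "Z \<in> Obj C" for x y v Z
    using that by (simp add: S_def \<Delta>_def m_def F tcom_split_right[OF \<mu>_hom E] del: whisker_left)
  \<comment> \<open>Two expressions for one arrow: \<open>S1\<close>, multiplication from the left,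
    reduces the left bimodule law to associativity; \<open>S2\<close>, multiplication from the
    right, does so for the right one.\<close>
  have S2: "S \<Delta> x v y Z = L x v (m v x y Z) \<cdot> F x v (a x y \<odot> Z)"
    if "x \<in> X" "y \<in> X" "v \<in> X" "Z \<in> Obj C" for x y v Z
    using that by (simp add: S1 comm)
  have "separability_structure C X a \<mu> \<Delta>"
    unfolding separability_structure_iff[OF h]
  proof (intro ballI conjI)
    fix x y v z Z
    assume [simp]: "x \<in> X" "y \<in> X" "v \<in> X" "z \<in> X" "Z \<in> Obj C"
    have "L x v (m v y z Z) \<cdot> S \<Delta> x v y (a y z \<odot> Z)
      = L x v (m v y z Z \<cdot> m v x y (a y z \<odot> Z)) \<cdot> F x v (a x y \<odot> (a y z \<odot> Z))"
      by (simp add: S2)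
    also have "\<dots> = L x v (m v x z Z) \<cdot> L x v (L v x (m x y z Z)) \<cdot> F x v (a x y \<odot> (a y z \<odot> Z))"
      by (simp add: m_assoc)
    \<comment> \<open>Naturality of \<open>F x v\<close> in its tail, from
      \<open>tcom_natural\<close> with source \<open>\<K>\<close> and naturality of the
      unitor.\<close>
    also have "L x v (L v x (m x y z Z)) \<cdot> F x v (a x y \<odot> (a y z \<odot> Z)) = F x v (a x z \<odot> Z) \<cdot> m x y z Z"
    proof -
      have "tcom (E x v) (a x v) (a v x) (a x z \<odot> Z) \<cdot> (\<one> \<K> \<otimes> m x y z Z)
        = L x v (L v x (m x y z Z)) \<cdot> tcom (E x v) (a x v) (a v x) (a x y \<odot> (a y z \<odot> Z))"
        by (rule tcom_natural[OF E]) simp_all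
      from Comp_reassoc[OF this] show ?thesis
        by (simp add: F tcom_arr[OF E] inv_Lunit_natural_arr)
    qed
    finally show "L x v (m v y z Z) \<cdot> S \<Delta> x v y (a y z \<odot> Z) = S \<Delta> x v z Z \<cdot> m x y z Z"
      by (simp add: S2)
    show "S \<Delta> x v z Z \<cdot> m x y z Z = m x y v (a v z \<odot> Z) \<cdot> L x y (S \<Delta> y v z Z)"
    proof -
      have "S \<Delta> x v z Z \<cdot> m x y z Z = m x z v (a v z \<odot> Z) \<cdot> (L x z (F z v Z) \<cdot> m x y z Z)"
        by (simp add: S1)
      also have "L x z (F z v Z) \<cdot> m x y z Z = m x y z (a z v \<odot> (a v z \<odot> Z)) \<cdot> L x y (L y z (F z v Z))"
        using m_natural[of x y z "F z v Z" "a z v \<odot> (a v z \<odot> Z)"] by simp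
      also have "m x z v (a v z \<odot> Z) \<cdot> (m x y z (a z v \<odot> (a v z \<odot> Z)) \<cdot> L x y (L y z (F z v Z)))
        = (m x z v (a v z \<odot> Z) \<cdot> m x y z (a z v \<odot> (a v z \<odot> Z))) \<cdot> L x y (L y z (F z v Z))"
        by simp
      also have "\<dots> = m x y v (a v z \<odot> Z) \<cdot> L x y (S \<Delta> y v z Z)"
        by (simp add: m_assoc S1)
      finally show ?thesis .
    qed
    have "m x v y Z \<cdot> S \<Delta> x v y Z = (m x v y Z \<cdot> m x y v (a v y \<odot> Z)) \<cdot> L x y (F y v Z)"
      by (simp add: S1)
    also have "\<dots> = m x y y Z \<cdot> L x y (m y v y Z \<cdot> F y v Z)"
      by (simp add: m_assoc)
    also have "\<dots> = \<one> (a x y \<odot> Z)"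
      by (simp add: norm m_u_right)
    finally show "m x v y Z \<cdot> S \<Delta> x v y Z = \<one> (a x y \<odot> Z)" .
  qed
  then show ?thesis
    by blast
qed

text \<open>In Sweedler notation \<open>F y v\<close> is \<theta>1 \<otimes> \<sigma>(\<theta>2).
  For p in \<open>a x y\<close> the Casimir identity reads p \<theta>1 \<otimes> \<sigma>(\<theta>2)
  = \<theta>1 \<otimes> \<sigma>(\<theta>2) p, with \<theta> at \<open>y\<close>, \<open>v\<close>
  on the left and at \<open>x\<close>, \<open>v\<close> on the right.\<close>

lemma left_integral_imp_separability:
  assumes int: "normalized_left_integral_family C X a \<epsilon> \<mu> \<theta>"
  shows "\<exists>\<Delta>. separability_structure C X a \<mu> \<Delta>"
proof -
  have h: "hom_family \<theta>"
    using int by (simp add: normalized_left_integral_family_def)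
  note int' = int[unfolded normalized_left_integral_family_iff[OF h]]
  have m_t: "m x y z Z \<cdot> L x y (t \<theta> y z Z) = t \<theta> x z Z \<cdot> e x y Z"
    if "x \<in> X" "y \<in> X" "z \<in> X" "Z \<in> Obj C" for x y z Z
    using int' that by blast
  have e_t: "e x y Z \<cdot> t \<theta> x y Z = \<one> Z" if "x \<in> X" "y \<in> X" "Z \<in> Obj C" for x y Z
    using int' that by blast
  define F where "F y v Z = L y v (s y v Z) \<cdot> d y v Z \<cdot> t \<theta> y v Z" for y v Z
  have F_arr [simp]: "F y v Z \<in> Arr C" "Dom C (F y v Z) = Z" "Cod C (F y v Z) = a y v \<odot> (a v y \<odot> Z)"
    if "y \<in> X" "v \<in> X" "Z \<in> Obj C" for y v Z
    using that h by (simp_all add: F_def)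
  \<comment> \<open>\<open>P\<close> sends p \<otimes> q to p1 q \<otimes> p2. With it
    \<open>d_m\<close> becomes: split q, apply \<open>P\<close>, multiply the last two legs.\<close>
  define P where "P x y v Z = m x y v (a x y \<odot> Z) \<cdot> L x y (g x y y v Z) \<cdot> d x y (a y v \<odot> Z)" for x y v Z
  have P_arr [simp]: "P x y v Z \<in> Arr C" "Dom C (P x y v Z) = a x y \<odot> (a y v \<odot> Z)"
    "Cod C (P x y v Z) = a x v \<odot> (a x y \<odot> Z)" if "x \<in> X" "y \<in> X" "v \<in> X" "Z \<in> Obj C" for x y v Z
    using that by (simp_all add: P_def)
  have P_natural: "P x y v Z' \<cdot> L x y (L y v f) = L x v (L x y f) \<cdot> P x y v (Dom C f)"
    if [simp]: "x \<in> X" "y \<in> X" "v \<in> X" "f \<in> Arr C" "Cod C f = Z'" for x y v f Z'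
  proof -
    have [simp]: "Z' \<in> Obj C" "Dom C f \<in> Obj C"
      using Cod_obj[of f] Dom_obj[of f] that(4,5) by auto
    have "L x y (g x y y v Z') \<cdot> L x y (L x y (L y v f)) = L x y (L y v (L x y f)) \<cdot> L x y (g x y y v (Dom C f))"
      using whisker_left_eq[OF g_natural[of x y y v f Z'], of "a x y"] by simp
    from Comp_reassoc[OF this] show ?thesis
      by (simp add: P_def d_natural Comp_reassoc[OF m_natural])
  qed
  \<comment> \<open>The canonical map p \<otimes> q to p1 \<otimes> p2 q, applied to p \<theta>1
    \<otimes> \<sigma>(\<theta>2): p1 \<theta>1 \<otimes> p2 \<theta>2 \<sigma>(\<theta>3) = p1
    \<theta> \<otimes> p2 = \<theta> \<otimes> p.\<close>
  have can: "(L x v (m x v y Z) \<cdot> d x v (a v y \<odot> Z)) \<cdot> (m x y v (a v y \<odot> Z) \<cdot> L x y (F y v Z))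
      = t \<theta> x v (a x y \<odot> Z)"
    if [simp]: "x \<in> X" "y \<in> X" "v \<in> X" "Z \<in> Obj C" for x y v Z
  proof -
    \<comment> \<open>The antipode part: \<theta>1 \<otimes> \<theta>2 \<sigma>(\<theta>3) =
      \<theta> \<otimes> 1.\<close>
    have LF: "L y v (m y v y Z) \<cdot> (d y v (a v y \<odot> Z) \<cdot> F y v Z) = L y v (u y Z) \<cdot> t \<theta> y v Z"
    proof -
      have "L y v (m y v y Z) \<cdot> (d y v (a v y \<odot> Z) \<cdot> F y v Z)
        = L y v (m y v y Z) \<cdot> L y v (L y v (s y v Z)) \<cdot> (d y v (a y v \<odot> Z) \<cdot> d y v Z) \<cdot> t \<theta> y v Z"
        using h by (simp add: F_def Comp_reassoc[OF d_natural])
      also have "\<dots> = L y v (m y v y Z \<cdot> L y v (s y v Z) \<cdot> d y v Z) \<cdot> d y v Z \<cdot> t \<theta> y v Z"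
        using h by (simp flip: d_coassoc)
      also have "\<dots> = L y v (u y Z) \<cdot> (L y v (e y v Z) \<cdot> d y v Z) \<cdot> t \<theta> y v Z"
        using h by (subst m_s_d_right) simp_all
      also have "\<dots> = L y v (u y Z) \<cdot> t \<theta> y v Z"
        using h by (simp add: e_d_right)
      finally show ?thesis .
    qed
    have "(L x v (m x v y Z) \<cdot> d x v (a v y \<odot> Z)) \<cdot> (m x y v (a v y \<odot> Z) \<cdot> L x y (F y v Z))
      = L x v (m x v y Z) \<cdot> (d x v (a v y \<odot> Z) \<cdot> m x y v (a v y \<odot> Z)) \<cdot> L x y (F y v Z)"
      by simp
    also have "\<dots> = L x v (m x v y Z \<cdot> m x y v (a v y \<odot> Z)) \<cdot> P x y v (a y v \<odot> (a v y \<odot> Z)) \<cdot>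
        L x y (d y v (a v y \<odot> Z) \<cdot> F y v Z)"
      by (simp add: d_m P_def)
    \<comment> \<open>Associativity regroups p2 (\<theta>2 \<sigma>(\<theta>3)); then
      \<open>P\<close> slides past the inner product by naturality, so that \<open>LF\<close>
      applies.\<close>
    also have "\<dots> = L x v (m x y y Z) \<cdot> (L x v (L x y (m y v y Z)) \<cdot> P x y v (a y v \<odot> (a v y \<odot> Z))) \<cdot>
        L x y (d y v (a v y \<odot> Z) \<cdot> F y v Z)"
      by (simp add: m_assoc)
    also have "\<dots> = L x v (m x y y Z) \<cdot> P x y v (a y y \<odot> Z) \<cdot>
        L x y (L y v (m y v y Z) \<cdot> (d y v (a v y \<odot> Z) \<cdot> F y v Z))"
      by (simp add: Comp_reassoc[OF P_natural])
    also have "\<dots> = L x v (m x y y Z) \<cdot> (P x y v (a y y \<odot> Z) \<cdot> L x y (L y v (u y Z))) \<cdot> L x y (t \<theta> y v Z)"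
      using h by (simp only: LF) simp
    also have "\<dots> = L x v (m x y y Z \<cdot> L x y (u y Z)) \<cdot> P x y v Z \<cdot> L x y (t \<theta> y v Z)"
      using h by (simp add: P_natural)
    also have "\<dots> = P x y v Z \<cdot> L x y (t \<theta> y v Z)"
      using h by (subst m_u_right) simp_all
    also have "\<dots> = m x y v (a x y \<odot> Z) \<cdot> L x y (g x y y v Z \<cdot> L x y (t \<theta> y v Z)) \<cdot> d x y Z"
      using h by (simp add: P_def d_natural)
    \<comment> \<open>The integral crosses the braiding, and p1 meets \<theta>.\<close>
    also have "\<dots> = (m x y v (a x y \<odot> Z) \<cdot> L x y (t \<theta> y v (a x y \<odot> Z))) \<cdot> d x y Z"
      using h by (simp add: g_t_right del: whisker_left)
    also have "\<dots> = t \<theta> x v (a x y \<odot> Z) \<cdot> (e x y (a x y \<odot> Z) \<cdot> d x y Z)"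
      using h by (simp add: m_t)
    also have "\<dots> = t \<theta> x v (a x y \<odot> Z)"
      using h by (simp add: e_d_left)
    finally show ?thesis .
  qed
  \<comment> \<open>The map p \<otimes> q to p1 \<otimes> \<sigma>(p2) q is a left inverse: p1
    \<otimes> \<sigma>(p2) p3 q = p \<otimes> q by the left antipode identity.\<close>
  have can_inv: "(L x v (m v x y Z) \<cdot> L x v (s x v (a x y \<odot> Z)) \<cdot> d x v (a x y \<odot> Z)) \<cdot>
      (L x v (m x v y Z) \<cdot> d x v (a v y \<odot> Z)) = \<one> (a x v \<odot> (a v y \<odot> Z))"
    if [simp]: "x \<in> X" "y \<in> X" "v \<in> X" "Z \<in> Obj C" for x y v Z
  proof -
    let ?W = "a v y \<odot> Z"
    have "(L x v (m v x y Z) \<cdot> L x v (s x v (a x y \<odot> Z)) \<cdot> d x v (a x y \<odot> Z)) \<cdot> (L x v (m x v y Z) \<cdot> d x v ?W)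
      = L x v (m v x y Z \<cdot> (s x v (a x y \<odot> Z) \<cdot> L x v (m x v y Z))) \<cdot> (d x v (a x v \<odot> ?W) \<cdot> d x v ?W)"
      by (simp add: Comp_reassoc[OF d_natural])
    also have "\<dots> = L x v ((m v x y Z \<cdot> L v x (m x v y Z)) \<cdot> s x v (a x v \<odot> ?W)) \<cdot> (L x v (d x v ?W) \<cdot> d x v ?W)"
      by (simp add: s_natural flip: d_coassoc)
    also have "\<dots> = L x v (m v v y Z \<cdot> (m v x v ?W \<cdot> s x v (a x v \<odot> ?W) \<cdot> d x v ?W)) \<cdot> d x v ?W"
      by (simp flip: m_assoc)
    also have "\<dots> = L x v ((m v v y Z \<cdot> u v ?W) \<cdot> e x v ?W) \<cdot> d x v ?W"
      by (subst m_s_d_left) simp_all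
    also have "\<dots> = \<one> (a x v \<odot> ?W)"
      by (simp add: m_u_left e_d_right)
    finally show ?thesis .
  qed
  show ?thesis
  proof (rule separability_structure_of_Casimir)
    show "(\<one> (a y v) \<otimes> \<sigma> y v) \<cdot> \<delta> y v \<cdot> \<theta> y v \<in> Hom C \<K> (a y v \<odot> a v y)"
      if "y \<in> X" "v \<in> X" for y v
      using that h \<sigma>_hom[of y v] \<delta>_hom[of y v] by (auto simp: Hom_def)
    show "F y v Z = tcom ((\<one> (a y v) \<otimes> \<sigma> y v) \<cdot> \<delta> y v \<cdot> \<theta> y v) (a y v) (a v y) Z \<cdot> inv (\<ll> Z)"
      if X: "y \<in> X" "v \<in> X" "Z \<in> Obj C" for y v Z
    proof -
      have th: "\<theta> y v \<in> Hom C \<K> (a y v)" and c: "\<delta> y v \<cdot> \<theta> y v \<in> Hom C \<K> (a y v \<odot> a y v)"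
        using X h \<delta>_hom[of y v] by (auto simp: Hom_def)
      show ?thesis
        using X th
        by (simp add: F_def s_def d_def t_def tcom_whisker_left[OF c \<sigma>_hom] tcom_Comp[OF \<delta>_hom th]
          tuni_def Hom_def tcom_arr[OF \<delta>_hom] \<sigma>_hom[THEN Hom_arr])
    qed
    \<comment> \<open>The identity is inserted as left inverse after canonical map.
      \<open>can\<close> evaluates the inner part to \<open>t \<theta>\<close>, and the left inverse
      on \<open>t \<theta>\<close> is the right side by definition of \<open>F\<close>.\<close>
    show "m x y v (a v y \<odot> Z) \<cdot> L x y (F y v Z) = L x v (m v x y Z) \<cdot> F x v (a x y \<odot> Z)"
      if [simp]: "x \<in> X" "y \<in> X" "v \<in> X" "Z \<in> Obj C" for x y v Z
    proof -
      have "m x y v (a v y \<odot> Z) \<cdot> L x y (F y v Z)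
        = \<one> (a x v \<odot> (a v y \<odot> Z)) \<cdot> (m x y v (a v y \<odot> Z) \<cdot> L x y (F y v Z))"
        by simp
      also have "\<dots> = (L x v (m v x y Z) \<cdot> L x v (s x v (a x y \<odot> Z)) \<cdot> d x v (a x y \<odot> Z)) \<cdot>
          ((L x v (m x v y Z) \<cdot> d x v (a v y \<odot> Z)) \<cdot> (m x y v (a v y \<odot> Z) \<cdot> L x y (F y v Z)))"
        by (subst can_inv[symmetric]) simp_all
      also have "\<dots> = (L x v (m v x y Z) \<cdot> L x v (s x v (a x y \<odot> Z)) \<cdot> d x v (a x y \<odot> Z)) \<cdot> t \<theta> x v (a x y \<odot> Z)"
        by (subst can) simp_all
      also have "\<dots> = L x v (m v x y Z) \<cdot> F x v (a x y \<odot> Z)"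
        using h by (simp add: F_def)
      finally show ?thesis .
    qed
    show "m y v y Z \<cdot> F y v Z = u y Z" if [simp]: "y \<in> X" "v \<in> X" "Z \<in> Obj C" for y v Z
    proof -
      have "m y v y Z \<cdot> F y v Z = (m y v y Z \<cdot> L y v (s y v Z) \<cdot> d y v Z) \<cdot> t \<theta> y v Z"
        using h by (simp add: F_def)
      also have "\<dots> = u y Z \<cdot> (e y v Z \<cdot> t \<theta> y v Z)"
        using h by (subst m_s_d_right) simp_all
      finally show ?thesis
        by (simp add: e_t)
    qed
  qed
qed

text \<open>Mirror image of the left case: \<open>F y v\<close> is \<sigma>(\<theta>1) \<otimes>
  \<theta>2.\<close>

lemma right_integral_imp_separability:
  assumes int: "normalized_right_integral_family C X a \<epsilon> \<mu> \<theta>"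
  shows "\<exists>\<Delta>. separability_structure C X a \<mu> \<Delta>"
proof -
  have h: "hom_family \<theta>"
    using int by (simp add: normalized_right_integral_family_def)
  note int' = int[unfolded normalized_right_integral_family_iff[OF h]]
  have m_t: "m x y z Z \<cdot> t \<theta> x y (a y z \<odot> Z) = t \<theta> x z Z \<cdot> e y z Z"
    if "x \<in> X" "y \<in> X" "z \<in> X" "Z \<in> Obj C" for x y z Z
    using int' that by blast
  have e_t: "e x y Z \<cdot> t \<theta> x y Z = \<one> Z" if "x \<in> X" "y \<in> X" "Z \<in> Obj C" for x y Z
    using int' that by blast
  \<comment> \<open>The integral is taken at \<open>v\<close>, \<open>y\<close>: the antipode acts
    on the first leg and turns \<open>a v y\<close> into \<open>a y v\<close>.\<close>
  define F where "F y v Z = s v y (a v y \<odot> Z) \<cdot> d v y Z \<cdot> t \<theta> v y Z" for y v Z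
  have F_arr [simp]: "F y v Z \<in> Arr C" "Dom C (F y v Z) = Z" "Cod C (F y v Z) = a y v \<odot> (a v y \<odot> Z)"
    if "y \<in> X" "v \<in> X" "Z \<in> Obj C" for y v Z
    using that h by (simp_all add: F_def)
  have F_natural: "F y v Z' \<cdot> f = L y v (L v y f) \<cdot> F y v (Dom C f)"
    if [simp]: "y \<in> X" "v \<in> X" "f \<in> Arr C" "Cod C f = Z'" for y v f Z'
  proof -
    have [simp]: "Z' \<in> Obj C" "Dom C f \<in> Obj C"
      using Cod_obj[of f] Dom_obj[of f] that(3,4) by auto
    show ?thesis
      using h by (simp add: F_def t_natural Comp_reassoc[OF d_natural] Comp_reassoc[OF s_natural])
  qed
  \<comment> \<open>The canonical map p \<otimes> q to p q1 \<otimes> q2, applied to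
    \<sigma>(\<theta>1) \<otimes> \<theta>2 p: \<sigma>(\<theta>1) \<theta>2 p1 \<otimes> \<theta>3
    p2 = p1 \<otimes> \<theta> p2 = p \<otimes> \<theta>.\<close>
  have can: "(m x v y (a v y \<odot> Z) \<cdot> L x v (d v y Z)) \<cdot> (L x v (m v x y Z) \<cdot> F x v (a x y \<odot> Z)) = L x y (t \<theta> v y Z)"
    if [simp]: "x \<in> X" "y \<in> X" "v \<in> X" "Z \<in> Obj C" for x y v Z
  proof -
    let ?Q = "a x y \<odot> Z"
    let ?V = "a v x \<odot> (a x y \<odot> ?Q)"
    \<comment> \<open>The antipode part: \<sigma>(\<theta>1) \<theta>2 \<otimes> \<theta>3 = 1
      \<otimes> \<theta>.\<close>
    have mF: "m x v x ?V \<cdot> L x v (d v x (a x y \<odot> ?Q)) \<cdot> F x v (a x y \<odot> ?Q) = u x ?V \<cdot> t \<theta> v x (a x y \<odot> ?Q)"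
    proof -
      have "m x v x ?V \<cdot> L x v (d v x (a x y \<odot> ?Q)) \<cdot> F x v (a x y \<odot> ?Q)
        = m x v x ?V \<cdot> (L x v (d v x (a x y \<odot> ?Q)) \<cdot> s v x ?V) \<cdot> d v x (a x y \<odot> ?Q) \<cdot> t \<theta> v x (a x y \<odot> ?Q)"
        using h by (simp add: F_def)
      also have "L x v (d v x (a x y \<odot> ?Q)) \<cdot> s v x ?V = s v x (a v x \<odot> ?V) \<cdot> L v x (d v x (a x y \<odot> ?Q))"
        by (simp add: s_natural)
      also have "m x v x ?V \<cdot> (s v x (a v x \<odot> ?V) \<cdot> L v x (d v x (a x y \<odot> ?Q))) \<cdot>
          d v x (a x y \<odot> ?Q) \<cdot> t \<theta> v x (a x y \<odot> ?Q)
        = m x v x ?V \<cdot> s v x (a v x \<odot> ?V) \<cdot> (L v x (d v x (a x y \<odot> ?Q)) \<cdot>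
          d v x (a x y \<odot> ?Q)) \<cdot> t \<theta> v x (a x y \<odot> ?Q)"
        using h by simp
      also have "\<dots> = (m x v x ?V \<cdot> s v x (a v x \<odot> ?V) \<cdot> d v x ?V) \<cdot> d v x (a x y \<odot> ?Q) \<cdot> t \<theta> v x (a x y \<odot> ?Q)"
        using h by (simp add: d_coassoc)
      also have "\<dots> = u x ?V \<cdot> (e v x ?V \<cdot> d v x (a x y \<odot> ?Q)) \<cdot> t \<theta> v x (a x y \<odot> ?Q)"
        using h by (subst m_s_d_left) simp_all
      also have "\<dots> = u x ?V \<cdot> t \<theta> v x (a x y \<odot> ?Q)"
        using h by (simp add: e_d_left)
      finally show ?thesis .
    qed
    have "(m x v y (a v y \<odot> Z) \<cdot> L x v (d v y Z)) \<cdot> (L x v (m v x y Z) \<cdot> F x v ?Q)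
      = m x v y (a v y \<odot> Z) \<cdot> L x v (d v y Z \<cdot> m v x y Z) \<cdot> F x v ?Q"
      by simp
    also have "\<dots> = (m x v y (a v y \<odot> Z) \<cdot> L x v (L v y (m v x y Z))) \<cdot> L x v (m v x y (a v x \<odot> ?Q)) \<cdot>
        L x v (L v x (g v x x y ?Q)) \<cdot> L x v (d v x (a x y \<odot> ?Q)) \<cdot> (L x v (L v x (d x y Z)) \<cdot> F x v ?Q)"
      by (subst d_m) simp_all
    also have "L x v (L v x (d x y Z)) \<cdot> F x v ?Q = F x v (a x y \<odot> ?Q) \<cdot> d x y Z"
      by (simp add: F_natural)
    also have "m x v y (a v y \<odot> Z) \<cdot> L x v (L v y (m v x y Z)) = L x y (m v x y Z) \<cdot> m x v y (a v x \<odot> ?Q)"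
      by (simp add: m_natural)
    also have "(L x y (m v x y Z) \<cdot> m x v y (a v x \<odot> ?Q)) \<cdot> L x v (m v x y (a v x \<odot> ?Q)) \<cdot>
        L x v (L v x (g v x x y ?Q)) \<cdot> L x v (d v x (a x y \<odot> ?Q)) \<cdot> (F x v (a x y \<odot> ?Q) \<cdot> d x y Z)
      = L x y (m v x y Z) \<cdot> (m x v y (a v x \<odot> ?Q) \<cdot> L x v (m v x y (a v x \<odot> ?Q))) \<cdot>
        L x v (L v x (g v x x y ?Q)) \<cdot> L x v (d v x (a x y \<odot> ?Q)) \<cdot> (F x v (a x y \<odot> ?Q) \<cdot> d x y Z)"
      by simp
    \<comment> \<open>Associativity detaches \<theta>2 from p1 and joins it to
      \<sigma>(\<theta>1).\<close>
    also have "m x v y (a v x \<odot> ?Q) \<cdot> L x v (m v x y (a v x \<odot> ?Q))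
      = m x x y (a v x \<odot> ?Q) \<cdot> m x v x (a x y \<odot> (a v x \<odot> ?Q))"
      by (simp add: m_assoc)
    also have "L x y (m v x y Z) \<cdot> (m x x y (a v x \<odot> ?Q) \<cdot> m x v x (a x y \<odot> (a v x \<odot> ?Q))) \<cdot>
        L x v (L v x (g v x x y ?Q)) \<cdot> L x v (d v x (a x y \<odot> ?Q)) \<cdot> (F x v (a x y \<odot> ?Q) \<cdot> d x y Z)
      = L x y (m v x y Z) \<cdot> m x x y (a v x \<odot> ?Q) \<cdot> (m x v x (a x y \<odot> (a v x \<odot> ?Q)) \<cdot>
        L x v (L v x (g v x x y ?Q))) \<cdot> L x v (d v x (a x y \<odot> ?Q)) \<cdot> (F x v (a x y \<odot> ?Q) \<cdot> d x y Z)"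
      by simp
    \<comment> \<open>The crossing of \<theta>3 with p1 is postponed until after this product, so
      that \<open>mF\<close> applies.\<close>
    also have "m x v x (a x y \<odot> (a v x \<odot> ?Q)) \<cdot> L x v (L v x (g v x x y ?Q)) = L x x (g v x x y ?Q) \<cdot> m x v x ?V"
      by (simp add: m_natural)
    also have "L x y (m v x y Z) \<cdot> m x x y (a v x \<odot> ?Q) \<cdot> (L x x (g v x x y ?Q) \<cdot> m x v x ?V) \<cdot>
        L x v (d v x (a x y \<odot> ?Q)) \<cdot> (F x v (a x y \<odot> ?Q) \<cdot> d x y Z)
      = L x y (m v x y Z) \<cdot> m x x y (a v x \<odot> ?Q) \<cdot> L x x (g v x x y ?Q) \<cdot>
        (m x v x ?V \<cdot> L x v (d v x (a x y \<odot> ?Q)) \<cdot> F x v (a x y \<odot> ?Q)) \<cdot> d x y Z"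
      by simp
    also have "\<dots> = L x y (m v x y Z) \<cdot> m x x y (a v x \<odot> ?Q) \<cdot> (L x x (g v x x y ?Q) \<cdot> u x ?V) \<cdot>
        t \<theta> v x (a x y \<odot> ?Q) \<cdot> d x y Z"
      using h by (simp only: mF) simp
    also have "L x x (g v x x y ?Q) \<cdot> u x ?V = u x (a x y \<odot> (a v x \<odot> ?Q)) \<cdot> g v x x y ?Q"
      by (simp add: u_natural)
    also have "L x y (m v x y Z) \<cdot> m x x y (a v x \<odot> ?Q) \<cdot> (u x (a x y \<odot> (a v x \<odot> ?Q)) \<cdot> g v x x y ?Q) \<cdot>
        t \<theta> v x (a x y \<odot> ?Q) \<cdot> d x y Z
      = L x y (m v x y Z) \<cdot> (m x x y (a v x \<odot> ?Q) \<cdot> u x (a x y \<odot> (a v x \<odot> ?Q))) \<cdot>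
        (g v x x y ?Q \<cdot> t \<theta> v x (a x y \<odot> ?Q)) \<cdot> d x y Z"
      using h by simp
    \<comment> \<open>The unit drops out and \<theta> crosses the braiding freely, which puts it
      directly in front of p2 for \<open>m_t\<close>.\<close>
    also have "\<dots> = L x y (m v x y Z \<cdot> t \<theta> v x ?Q) \<cdot> d x y Z"
      using h by (simp add: m_u_left g_t_left)
    also have "\<dots> = L x y (t \<theta> v y Z) \<cdot> (L x y (e x y Z) \<cdot> d x y Z)"
      using h by (subst m_t) simp_all
    also have "\<dots> = L x y (t \<theta> v y Z)"
      using h by (simp add: e_d_right)
    finally show ?thesis .
  qed
  \<comment> \<open>The left inverse is p \<otimes> q to p \<sigma>(q1) \<otimes> q2: p q1
    \<sigma>(q2) \<otimes> q3 = p \<otimes> q by the right antipode identity.\<close>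
  have can_inv: "(m x y v (a v y \<odot> Z) \<cdot> L x y (s v y (a v y \<odot> Z) \<cdot> d v y Z)) \<cdot>
      (m x v y (a v y \<odot> Z) \<cdot> L x v (d v y Z)) = \<one> (a x v \<odot> (a v y \<odot> Z))"
    if [simp]: "x \<in> X" "y \<in> X" "v \<in> X" "Z \<in> Obj C" for x y v Z
  proof -
    let ?W = "a v y \<odot> Z"
    have "(m x y v ?W \<cdot> L x y (s v y ?W \<cdot> d v y Z)) \<cdot> (m x v y ?W \<cdot> L x v (d v y Z))
      = m x y v ?W \<cdot> (L x y (s v y ?W \<cdot> d v y Z) \<cdot> m x v y ?W) \<cdot> L x v (d v y Z)"
      by simp
    also have "L x y (s v y ?W \<cdot> d v y Z) \<cdot> m x v y ?W
      = m x v y (a y v \<odot> ?W) \<cdot> L x v (L v y (s v y ?W \<cdot> d v y Z))"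
      using m_natural[of x v y "s v y ?W \<cdot> d v y Z" "a y v \<odot> ?W"] by simp
    also have "m x y v ?W \<cdot> (m x v y (a y v \<odot> ?W) \<cdot> L x v (L v y (s v y ?W \<cdot> d v y Z))) \<cdot> L x v (d v y Z)
      = (m x y v ?W \<cdot> m x v y (a y v \<odot> ?W)) \<cdot> L x v (L v y (s v y ?W) \<cdot> (L v y (d v y Z) \<cdot> d v y Z))"
      by simp
    also have "\<dots> = m x v v ?W \<cdot> L x v ((m v y v ?W \<cdot> L v y (s v y ?W) \<cdot> d v y ?W) \<cdot> d v y Z)"
      by (simp add: m_assoc d_coassoc)
    also have "\<dots> = (m x v v ?W \<cdot> L x v (u v ?W)) \<cdot> L x v (e v y ?W \<cdot> d v y Z)"
      by (subst m_s_d_right) simp_all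
    also have "\<dots> = \<one> (a x v \<odot> ?W)"
      by (simp add: m_u_right e_d_left del: whisker_left)
    finally show ?thesis .
  qed
  show ?thesis
  proof (rule separability_structure_of_Casimir)
    show "(\<sigma> v y \<otimes> \<one> (a v y)) \<cdot> \<delta> v y \<cdot> \<theta> v y \<in> Hom C \<K> (a y v \<odot> a v y)"
      if "y \<in> X" "v \<in> X" for y v
      using that h \<sigma>_hom[of v y] \<delta>_hom[of v y] by (auto simp: Hom_def)
    show "F y v Z = tcom ((\<sigma> v y \<otimes> \<one> (a v y)) \<cdot> \<delta> v y \<cdot> \<theta> v y) (a y v) (a v y) Z \<cdot> inv (\<ll> Z)"
      if X: "y \<in> X" "v \<in> X" "Z \<in> Obj C" for y v Z
    proof -
      have th: "\<theta> v y \<in> Hom C \<K> (a v y)" and c: "\<delta> v y \<cdot> \<theta> v y \<in> Hom C \<K> (a v y \<odot> a v y)"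
        using X h \<delta>_hom[of v y] by (auto simp: Hom_def)
      show ?thesis
        using X th
        by (simp add: F_def s_def d_def t_def tcom_whisker_right[OF c \<sigma>_hom] tcom_Comp[OF \<delta>_hom th]
          tuni_def Hom_def tcom_arr[OF \<delta>_hom] \<sigma>_hom[THEN Hom_arr])
    qed
    \<comment> \<open>The computation starts at the right side, on which \<open>can\<close>
      evaluates the canonical map; the closing \<open>..\<close> reverses the resulting
      equation.\<close>
    show "m x y v (a v y \<odot> Z) \<cdot> L x y (F y v Z) = L x v (m v x y Z) \<cdot> F x v (a x y \<odot> Z)"
      if [simp]: "x \<in> X" "y \<in> X" "v \<in> X" "Z \<in> Obj C" for x y v Z
    proof -
      have "L x v (m v x y Z) \<cdot> F x v (a x y \<odot> Z)
        = \<one> (a x v \<odot> (a v y \<odot> Z)) \<cdot> (L x v (m v x y Z) \<cdot> F x v (a x y \<odot> Z))"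
        by simp
      also have "\<dots> = (m x y v (a v y \<odot> Z) \<cdot> L x y (s v y (a v y \<odot> Z) \<cdot> d v y Z)) \<cdot>
          ((m x v y (a v y \<odot> Z) \<cdot> L x v (d v y Z)) \<cdot> (L x v (m v x y Z) \<cdot> F x v (a x y \<odot> Z)))"
        by (subst can_inv[symmetric]) simp_all
      also have "\<dots> = (m x y v (a v y \<odot> Z) \<cdot> L x y (s v y (a v y \<odot> Z) \<cdot> d v y Z)) \<cdot> L x y (t \<theta> v y Z)"
        by (subst can) simp_all
      also have "\<dots> = m x y v (a v y \<odot> Z) \<cdot> L x y (F y v Z)"
        using h by (simp add: F_def)
      finally show ?thesis ..
    qed
    show "m y v y Z \<cdot> F y v Z = u y Z" if [simp]: "y \<in> X" "v \<in> X" "Z \<in> Obj C" for y v Z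
    proof -
      have "m y v y Z \<cdot> F y v Z = (m y v y Z \<cdot> s v y (a v y \<odot> Z) \<cdot> d v y Z) \<cdot> t \<theta> v y Z"
        using h by (simp add: F_def)
      also have "\<dots> = u y Z \<cdot> (e v y Z \<cdot> t \<theta> v y Z)"
        using h by (subst m_s_d_left) simp_all
      finally show ?thesis
        by (simp add: e_t)
    qed
  qed
qed

end

section \<open>Equivalence of separability with the existence of normalized integrals on either
  side\<close>

theorem theorem4p8:
  fixes C :: "('o, 'm) brcat"
    and X :: "'x set"
    and a :: "'x \<Rightarrow> 'x \<Rightarrow> 'o"
    and \<delta> \<epsilon> :: "'x \<Rightarrow> 'x \<Rightarrow> 'm"
    and \<mu> :: "'x \<Rightarrow> 'x \<Rightarrow> 'x \<Rightarrow> 'm"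
    and \<eta> :: "'x \<Rightarrow> 'm"
  assumes "braided_monoidal_category C"
    and "hopf_category C X a \<delta> \<epsilon> \<mu> \<eta>"
  shows "((\<exists>\<Delta>. separability_structure C X a \<mu> \<Delta>) \<longleftrightarrow>
          (\<exists>\<theta>. normalized_left_integral_family C X a \<epsilon> \<mu> \<theta>)) \<and>
         ((\<exists>\<theta>. normalized_left_integral_family C X a \<epsilon> \<mu> \<theta>) \<longleftrightarrow>
          (\<exists>\<theta>. normalized_right_integral_family C X a \<epsilon> \<mu> \<theta>))"
proof -
  interpret braided_monoidal_category C
    by (rule assms(1))
  obtain \<sigma> where "hopf_category_with_antipode C X a \<delta> \<epsilon> \<mu> \<eta> \<sigma>"
    using assms(2) unfolding hopf_category_def
    by (metis hopf_category_with_antipode.intro hopf_category_with_antipode_axioms.intro assms(1))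
  then interpret hopf_category_with_antipode C X a \<delta> \<epsilon> \<mu> \<eta> \<sigma> .
  \<comment> \<open>Left and right integrals are linked through separability structures.\<close>
  show ?thesis
    using separability_imp_left_integral separability_imp_right_integral
      left_integral_imp_separability right_integral_imp_separability by blast
qed

end
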